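(* There is a fixed finitely generated submonoid of the free metabelian group of rank $2$ whose membership problem is undecidable.
   Context: The free metabelian group of rank $2$ is $F/[[F,F],[F,F]]$ where $F$ is the free group on two generators $x,y$. The membership problem for a submonoid $S$ asks, given a word over $\{x,y,x^{-1},y^{-1}\}$, whether the element it represents lies in $S$. *)

theory Defs
  imports Main
begin

datatype letter = Lx | Ly | LxI | LyI

type_synonym word = "letter list"

fun inv_letter :: "letter \<Rightarrow> letter" where
  "inv_letter Lx = LxI"
| "inv_letter Ly = LyI"
| "inv_letter LxI = Lx"
| "inv_letter LyI = Ly"

definition inv_word :: "word \<Rightarrow> word" where
  "inv_word w = rev (map inv_letter w)"

definition comm :: "word \<Rightarrow> word \<Rightarrow> word" where
  "comm a b = inv_word a @ inv_word b @ a @ b"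

text \<open>Two words represent the same element of F/F'' iff they are related by the
  smallest congruence (w.r.t. concatenation) that contains free cancellation and
  kills all elements [[a,b],[c,d]] (whose normal closure in F is exactly F'').\<close>

inductive meq :: "word \<Rightarrow> word \<Rightarrow> bool" where
  meq_refl: "meq w w"
| meq_sym: "meq u v \<Longrightarrow> meq v u"
| meq_trans: "meq u v \<Longrightarrow> meq v w \<Longrightarrow> meq u w"
| meq_cancel: "meq (u @ [l, inv_letter l] @ v) (u @ v)"
| meq_metab: "meq (u @ comm (comm a b) (comm c d) @ v) (u @ v)"

definition in_submonoid :: "word list \<Rightarrow> word \<Rightarrow> bool" where
  "in_submonoid gens w \<longleftrightarrow>
     (\<exists>ks. set ks \<subseteq> set gens \<and> meq w (concat ks))"

datatype recf = Zero | Succ | Proj nat | Comp recf "recf list" | Prec recf recf | Mini recf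

inductive eval :: "recf \<Rightarrow> nat list \<Rightarrow> nat \<Rightarrow> bool" where
  ev_zero: "eval Zero xs 0"
| ev_succ: "eval Succ (x # xs) (Suc x)"
| ev_proj: "i < length xs \<Longrightarrow> eval (Proj i) xs (xs ! i)"
| ev_comp: "list_all2 (\<lambda>g y. eval g xs y) gs ys \<Longrightarrow> eval f ys z \<Longrightarrow> eval (Comp f gs) xs z"
| ev_prec0: "eval f xs y \<Longrightarrow> eval (Prec f g) (0 # xs) y"
| ev_precS: "eval (Prec f g) (n # xs) y \<Longrightarrow> eval g (n # y # xs) z \<Longrightarrow>
             eval (Prec f g) (Suc n # xs) z"
| ev_mini: "eval f (n # xs) 0 \<Longrightarrow> (\<forall>m<n. \<exists>y. eval f (m # xs) y \<and> 0 < y) \<Longrightarrow>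
            eval (Mini f) xs n"

definition decidable_nat :: "nat set \<Rightarrow> bool" where
  "decidable_nat A \<longleftrightarrow> (\<exists>f. \<forall>n. eval f [n] (if n \<in> A then 1 else 0))"

text \<open>Goedel numbering of words (bijective base-5 style, injective).\<close>
fun letter_code :: "letter \<Rightarrow> nat" where
  "letter_code Lx = 1" | "letter_code Ly = 2" | "letter_code LxI = 3" | "letter_code LyI = 4"

fun word_code :: "word \<Rightarrow> nat" where
  "word_code [] = 0"
| "word_code (l # w) = letter_code l + 5 * word_code w"

definition decidable_words :: "(word \<Rightarrow> bool) \<Rightarrow> bool" where
  "decidable_words P \<longleftrightarrow> decidable_nat (word_code ` {w. P w})"

end

theory Submission
  imports Defs "HOL-Library.Product_Plus" "HOL-Library.Multiset" "HOL-Library.Infinite_Set"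
    "HOL-Computational_Algebra.Polynomial"
begin

text \<open>By the Magnus embedding, a word is determined in the free metabelian group by its end
  point in the grid and by the signed number of times it crosses each vertical edge. Take the
  generators \<open>x\<^sup>m\<close>, \<open>x\<^sup>-\<^sup>m\<close>, \<open>y\<close>, \<open>y\<^sup>-\<^sup>1\<close> and some closed words: the first four
  only cross edges in columns divisible by \<open>m\<close>, so the other \<open>m - 1\<close> columns modulo \<open>m\<close> record a
  combination of translates of the closed words with coefficients in the natural numbers. Hence
  membership expresses solvability of a translation invariant linear system whose unknowns are
  finitely supported functions from the grid to the natural numbers.

  Such systems encode derivations from Horn clauses over the natural numbers whose terms are
  polynomials. Each clause instance occupies one column \<open>t\<close> of the grid, and a term of value \<open>v\<close>
  is represented by the monomial \<open>X\<^sup>tY\<^sup>v\<close>. Linear equations can multiply since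
  \<open>(Y\<^sup>a - 1)(Y\<^sup>b - 1)\<close> and \<open>(Y - 1)(Y\<^sup>a\<^sup>b - 1)\<close> agree modulo \<open>(Y - 1)\<^sup>3\<close>. Open obligations
  only travel to the right, so derivations are well-founded. The evaluation relation of recursive
  functions is given by Horn clauses, and diagonalisation finishes the proof.\<close>

section \<open>The Magnus embedding\<close>

text \<open>The obstacle is rigidity. The equations are translation invariant, so they cannot single
  out an origin or by themselves forbid several superposed computations; the only inhomogeneous
  datum is the target word, with right-hand side \<open>1\<close> in one equation and
  \<open>Y^n\<close> in another. Rigidity comes from order: a nonnegative, finitely supported
  function that can increase at only one place, and there by at most one, is bounded by one. Along
  \<open>X\<close> this leaves at most one clause per column, along \<open>Y\<close> exactly one
  token per term of that clause. The exponent 3 is the first that sees products: modulo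
  \<open>(Y - 1)^2\<close> a polynomial is known by its value and derivative at 1, which are linear
  in the exponents; only the second derivative is quadratic in them. The generators depend on the
  clauses alone and the goal number only enters the target word. As recursive functions enter the
  clauses through their codes, one finite list of clauses, hence one submonoid, serves all
  queries.\<close>

lemma meq_context: "meq u v \<Longrightarrow> meq (a @ u @ b) (a @ v @ b)"
proof (induction rule: meq.induct)
  case (meq_cancel u l v)
  then show ?case using meq.meq_cancel[of "a @ u" l "v @ b"] by simp
next
  case (meq_metab u x y z t v)
  then show ?case using meq.meq_metab[of "a @ u" x y z t "v @ b"] by simp
qed (auto intro: meq.intros)

lemma meq_append: "meq u u' \<Longrightarrow> meq v v' \<Longrightarrow> meq (u @ v) (u' @ v')"
  using meq_context[of u u' "[]" v] meq_context[of v v' u' "[]"] meq_trans by auto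

lemma inv_letter_inv_letter [simp]: "inv_letter (inv_letter l) = l"
  by (cases l) auto

lemma inv_word_simps [simp]:
  "inv_word [] = []"
  "inv_word (u @ v) = inv_word v @ inv_word u"
  "inv_word (l # v) = inv_word v @ [inv_letter l]"
  "inv_word (inv_word v) = v"
  by (auto simp: inv_word_def rev_map comp_def)

lemma meq_append_inv: "meq (u @ inv_word u) []"
proof (induction u)
  case (Cons l u)
  have "meq ([l] @ (u @ inv_word u) @ [inv_letter l]) ([l] @ [] @ [inv_letter l])"
    using Cons meq_context by blast
  moreover have "meq ([l] @ [] @ [inv_letter l]) []"
    using meq_cancel[of "[]" l "[]"] by simp
  ultimately show ?case using meq_trans by auto
qed (auto intro: meq_refl)

lemma meq_inv_append: "meq (inv_word u @ u) []"
  using meq_append_inv[of "inv_word u"] by simp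

lemma meq_inv_word:
  assumes "meq u v" shows "meq (inv_word u) (inv_word v)"
proof -
  have "meq (inv_word u @ v @ inv_word v) (inv_word u @ [])"
    by (rule meq_append[OF meq_refl meq_append_inv])
  moreover have "meq (inv_word u @ u @ inv_word v) (inv_word u @ v @ inv_word v)"
    by (rule meq_context[OF assms])
  moreover have "meq ((inv_word u @ u) @ inv_word v) ([] @ inv_word v)"
    by (rule meq_append[OF meq_inv_append meq_refl])
  ultimately show ?thesis
    by (metis append_Nil append_Nil2 append_assoc meq_sym meq_trans)
qed

lemma equivp_meq: "equivp meq"
  by (intro equivpI reflpI sympI transpI) (auto intro: meq.intros)

quotient_type fmet = word / meq
  by (rule equivp_meq)

instantiation fmet :: group_add
begin

lift_definition zero_fmet :: fmet is "[]" .
lift_definition plus_fmet :: "fmet \<Rightarrow> fmet \<Rightarrow> fmet" is "(@)"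
  by (rule meq_append)
lift_definition uminus_fmet :: "fmet \<Rightarrow> fmet" is inv_word
  by (rule meq_inv_word)
definition minus_fmet :: "fmet \<Rightarrow> fmet \<Rightarrow> fmet" where "minus_fmet a b = a + - b"

instance
proof
  fix a b c :: fmet
  show "a + b + c = a + (b + c)" by transfer (simp add: meq_refl)
  show "0 + a = a" by transfer (simp add: meq_refl)
  show "a + 0 = a" by transfer (simp add: meq_refl)
  show "- a + a = 0" by transfer (rule meq_inv_append)
  show "a + - b = a - b" by (simp add: minus_fmet_def)
qed

end

lift_definition cls :: "word \<Rightarrow> fmet" is "\<lambda>w. w" .

lemma cls_eq_iff: "cls u = cls v \<longleftrightarrow> meq u v"
  by transfer simp

lemma cls_simps [simp]:
  "cls [] = 0" "cls (u @ v) = cls u + cls v" "cls (inv_word u) = - cls u"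
  by (transfer, simp add: meq_refl)+

lemma cls_Cons: "cls (l # v) = cls [l] + cls v"
  using cls_simps(2)[of "[l]" v] by simp

lemma cls_inv_letter: "cls [inv_letter l] = - cls [l]"
  using cls_simps(3)[of "[l]"] by simp

definition gcomm :: "'a::group_add \<Rightarrow> 'a \<Rightarrow> 'a" where
  "gcomm a b = - a + - b + a + b"

definition gconj :: "'a::group_add \<Rightarrow> 'a \<Rightarrow> 'a" where
  "gconj g h = g + h + - g"

lemmas group_simps = diff_conv_add_uminus add.assoc minus_add minus_minus minus_zero
  add.left_inverse add.right_inverse add_minus_cancel minus_add_cancel add_0_left add_0_right

text \<open>The relation \<open>meq_metab\<close> in group form. Single commutators suffice later,
  since a conjugate of a commutator is again a commutator (\<open>gconj_gcomm\<close>).\<close>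

lemma gcomm_commute:
  fixes a b c d :: fmet
  shows "gcomm a b + gcomm c d = gcomm c d + gcomm a b"
proof -
  have *: "gcomm (gcomm a b) (gcomm c d) = 0"
    unfolding gcomm_def
  proof transfer
    fix a b c d
    show "meq (((inv_word (((inv_word a @ inv_word b) @ a) @ b) @
          inv_word (((inv_word c @ inv_word d) @ c) @ d)) @
          ((inv_word a @ inv_word b) @ a) @ b) @ ((inv_word c @ inv_word d) @ c) @ d) []"
      using meq_metab[of "[]" a b c d "[]"] by (simp add: comm_def)
  qed
  have "- (gcomm c d + gcomm a b) + (gcomm a b + gcomm c d) = 0"
    using * unfolding gcomm_def[of "gcomm a b"] by (simp only: minus_add add.assoc)
  then show ?thesis using neg_eq_iff_add_eq_0 by (metis add.inverse_inverse minus_unique)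
qed

lemma gconj_simps:
  fixes g :: "'a::group_add"
  shows "gconj g (a + b) = gconj g a + gconj g b" "gconj g (- a) = - gconj g a"
    "gconj g 0 = 0" "gconj (g + h) a = gconj g (gconj h a)" "gconj 0 a = a"
  unfolding gconj_def by (simp_all only: group_simps)

lemma gconj_gcomm: "gconj g (gcomm a b) = gcomm (gconj g a) (gconj g b)"
  by (simp only: gcomm_def gconj_simps)

section \<open>End point and vertical flow as invariants of the group element\<close>

definition step :: "letter \<Rightarrow> int \<times> int" where
  "step l = (case l of Lx \<Rightarrow> (1, 0) | Ly \<Rightarrow> (0, 1) | LxI \<Rightarrow> (-1, 0) | LyI \<Rightarrow> (0, -1))"

lemma step_simps [simp]:
  "step Lx = (1, 0)" "step Ly = (0, 1)" "step LxI = (-1, 0)" "step LyI = (0, -1)"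
  by (simp_all add: step_def)

definition pos :: "word \<Rightarrow> int \<times> int" where
  "pos w = sum_list (map step w)"

text \<open>A vertical edge is named by its lower end, so \<open>LyI\<close> is charged to
  \<open>(0, -1)\<close>. Horizontal edges can be left out: a finite cycle of the grid without
  vertical flow has constant flow along each row, hence none.\<close>

definition lflow :: "letter \<Rightarrow> int \<times> int \<Rightarrow> int" where
  "lflow l p = (case l of Ly \<Rightarrow> of_bool (p = (0, 0)) | LyI \<Rightarrow> - of_bool (p = (0, -1)) | _ \<Rightarrow> 0)"

lemma lflow_simps [simp]:
  "lflow Lx p = 0" "lflow LxI p = 0"
  "lflow Ly p = of_bool (p = (0, 0))" "lflow LyI p = - of_bool (p = (0, -1))"
  by (simp_all add: lflow_def)

primrec flow :: "word \<Rightarrow> int \<times> int \<Rightarrow> int" where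
  "flow [] p = 0"
| "flow (l # w) p = lflow l p + flow w (p - step l)"

lemma pos_simps [simp]:
  "pos [] = 0" "pos (l # w) = step l + pos w" "pos (u @ v) = pos u + pos v"
  by (auto simp: pos_def)

lemma step_inv_letter [simp]: "step (inv_letter l) = - step l"
  by (cases l) auto

lemma pos_inv_word [simp]: "pos (inv_word w) = - pos w"
  by (induction w) (auto simp: algebra_simps)

lemma flow_append [simp]: "flow (u @ v) p = flow u p + flow v (p - pos u)"
  by (induction u arbitrary: p) (auto simp: algebra_simps)

lemma lflow_inv_letter: "lflow (inv_letter l) p = - lflow l (p + step l)"
  by (cases l; cases p) auto

lemma flow_inv_word: "flow (inv_word w) p = - flow w (p + pos w)"
  by (induction w arbitrary: p) (auto simp: algebra_simps lflow_inv_letter)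

text \<open>The inner commutators are closed words, on which flow is additive without any shift, so
  the four contributions to the outer commutator cancel.\<close>

lemma meq_pos_flow: "meq u v \<Longrightarrow> pos u = pos v \<and> flow u = flow v"
proof (induction rule: meq.induct)
  case (meq_cancel u l v)
  then show ?case by (auto simp: lflow_inv_letter algebra_simps)
next
  case (meq_metab u a b c d v)
  have "pos (comm x y) = 0" for x y by (simp add: comm_def)
  moreover have "flow (comm x y) p = 0" if "pos x = 0" "pos y = 0" for x y p
    using that by (simp add: comm_def flow_inv_word)
  ultimately show ?case by auto
qed auto

section \<open>Normal form: conjugates of one commutator, followed by a power of \<open>x\<close>
  and a power of \<open>y\<close>\<close>

definition letter_pow :: "letter \<Rightarrow> int \<Rightarrow> word" where
  "letter_pow l z = (if z \<ge> 0 then replicate (nat z) l else replicate (nat (- z)) (inv_letter l))"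

lemma letter_pow_0 [simp]: "letter_pow l 0 = []"
  by (simp add: letter_pow_def)

lemma cls_letter_pow_Suc: "cls (letter_pow l (z + 1)) = cls [l] + cls (letter_pow l z)"
proof (cases "z \<ge> 0")
  case True
  then show ?thesis
    by (simp add: letter_pow_def nat_add_distrib cls_Cons[of l "replicate _ _"])
next
  case False
  then have "nat (- z) = Suc (nat (- (z + 1)))" by simp
  then have "cls (letter_pow l z) = cls [inv_letter l] + cls (replicate (nat (- (z + 1))) (inv_letter l))"
    using False by (simp add: letter_pow_def cls_Cons[of _ "replicate _ _"])
  moreover have "letter_pow l (z + 1) = replicate (nat (- (z + 1))) (inv_letter l)"
    using False by (auto simp: letter_pow_def)
  ultimately show ?thesis by (simp add: cls_inv_letter add.assoc[symmetric])
qed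

lemma pos_replicate: "pos (replicate n l) = (int n * fst (step l), int n * snd (step l))"
  by (induction n) (auto simp: algebra_simps zero_prod_def plus_prod_def)

lemma pos_letter_pow: "pos (letter_pow l z) = (z * fst (step l), z * snd (step l))"
  by (simp add: letter_pow_def pos_replicate)

abbreviation "gx \<equiv> cls [Lx]"
abbreviation "gy \<equiv> cls [Ly]"

definition xy :: "int \<times> int \<Rightarrow> word" where
  "xy p = letter_pow Lx (fst p) @ letter_pow Ly (snd p)"

lemma pos_xy [simp]: "pos (xy p) = p"
  by (simp add: xy_def pos_letter_pow)

text \<open>The boundary of a unit square, traversed counterclockwise; as
  \<open>x^-1 y^-1 x y\<close> starts to the left and then down, \<open>p\<close> is its upper right
  corner.\<close>

definition cell :: "int \<times> int \<Rightarrow> fmet" where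
  "cell p = gconj (cls (xy p)) (gcomm gx gy)"

lemma cell_gcomm: "\<exists>a b. cell p = gcomm a b"
  by (auto simp: cell_def gconj_gcomm)

lemma gconj_gx_cell: "gconj gx (cell p) = cell (p + (1, 0))"
  by (cases p) (simp add: cell_def xy_def gconj_simps cls_letter_pow_Suc)

text \<open>In \<open>xy p\<close> the power of \<open>x\<close> stands on the left, so
  \<open>y\<close> has to pass it. This costs a commutator, and conjugating a cell by a commutator
  does nothing.\<close>

lemma gconj_gy_cell: "gconj gy (cell p) = cell (p + (0, 1))"
proof -
  let ?x = "cls (letter_pow Lx (fst p))" and ?y = "cls (letter_pow Ly (snd p))"
  let ?k = "gcomm (- gy) (- ?x)"
  have k: "gy + ?x = ?k + (?x + gy)"
    by (simp only: gcomm_def group_simps)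
  have "gconj gy (cell p) = gconj (gy + ?x + ?y) (gcomm gx gy)"
    by (simp add: cell_def xy_def gconj_simps)
  also have "\<dots> = gconj ?k (gconj (?x + (gy + ?y)) (gcomm gx gy))"
    unfolding k by (simp add: gconj_simps)
  also have "gconj (?x + (gy + ?y)) (gcomm gx gy) = cell (p + (0, 1))"
    by (cases p) (simp add: cell_def xy_def cls_letter_pow_Suc)
  also have "gconj ?k (cell (p + (0, 1))) = cell (p + (0, 1))"
    unfolding gconj_def using cell_gcomm[of "p + (0,1)"]
    by (metis add.assoc add.right_inverse add.right_neutral gcomm_commute)
  finally show ?thesis .
qed

lemma gconj_gx_neg_cell: "gconj (- gx) (cell p) = cell (p - (1, 0))"
  using gconj_gx_cell[of "p - (1, 0)"] gconj_simps(4)[of "- gx" gx] gconj_simps(5)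
  by (metis diff_add_cancel left_minus)

lemma gconj_gy_neg_cell: "gconj (- gy) (cell p) = cell (p - (0, 1))"
  using gconj_gy_cell[of "p - (0, 1)"] gconj_simps(4)[of "- gy" gy] gconj_simps(5)
  by (metis diff_add_cancel left_minus)

lemma gconj_letter_cell: "gconj (cls [l]) (cell p) = cell (p + step l)"
proof (cases l)
  case LxI
  then show ?thesis using gconj_gx_neg_cell[of p] cls_inv_letter[of Lx] by (cases p) simp
next
  case LyI
  then show ?thesis using gconj_gy_neg_cell[of p] cls_inv_letter[of Ly] by (cases p) simp
qed (auto simp: gconj_gx_cell gconj_gy_cell)

definition cells :: "((int \<times> int) \<times> bool) list \<Rightarrow> fmet" where
  "cells L = sum_list (map (\<lambda>(p, s). if s then cell p else - cell p) L)"

lemma cells_simps [simp]: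
  "cells [] = 0" "cells ((p, s) # L) = (if s then cell p else - cell p) + cells L"
  "cells (L @ M) = cells L + cells M"
  by (auto simp: cells_def)

lemma uminus_cells: "\<exists>M. - cells L = cells M"
proof (induction L)
  case Nil
  then show ?case by (metis cells_simps(1) minus_zero)
next
  case (Cons a L)
  obtain p s where a: "a = (p, s)" by (cases a)
  from Cons obtain M where "- cells L = cells M" by blast
  then have "- cells (a # L) = cells (M @ [(p, \<not> s)])"
    unfolding a by (simp add: minus_add)
  then show ?case by blast
qed

lemma gconj_letter_cells: "\<exists>M. gconj (cls [l]) (cells L) = cells M"
proof (induction L)
  case Nil
  then show ?case by (metis cells_simps(1) gconj_simps(3))
next
  case (Cons a L)
  obtain p s where a: "a = (p, s)" by (cases a)
  from Cons obtain M where "gconj (cls [l]) (cells L) = cells M" by blast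
  then have "gconj (cls [l]) (cells (a # L)) = cells ((p + step l, s) # M)"
    unfolding a by (simp add: gconj_simps gconj_letter_cell)
  then show ?case by blast
qed

lemma gconj_uminus_letter_cells: "\<exists>M. gconj (- cls [l]) (cells L) = cells M"
  using gconj_letter_cells[of "inv_letter l" L] by (simp add: cls_inv_letter)

lemma cell_1_1: "cell (1, 1) = gx + gy + - gx + - gy"
proof -
  have "letter_pow l 1 = [l]" for l by (simp add: letter_pow_def)
  then have "cell (1, 1) = gconj (gx + gy) (gcomm gx gy)"
    by (simp add: cell_def xy_def cls_Cons[of Lx "[Ly]"])
  then show ?thesis by (simp only: gconj_def gcomm_def group_simps)
qed

text \<open>Each exchange of \<open>y\<close> with one \<open>x\<close> costs one cell or its
  inverse, the cell being \<open>x y x^-1 y^-1\<close>; earlier cells are merely shifted by the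
  conjugation.\<close>

lemma gy_pow_gx_cells:
  "\<exists>L. gy + cls (letter_pow Lx i) = cells L + (cls (letter_pow Lx i) + gy)"
proof (induction i rule: int_induct[where k = 0])
  case base
  then show ?case by (auto intro: exI[of _ "[]"])
next
  case (step1 i)
  let ?x = "cls (letter_pow Lx i)"
  obtain L where L: "gy + ?x = cells L + (?x + gy)" using step1 by blast
  obtain M where M: "gconj gx (cells L) = cells M" using gconj_letter_cells by blast
  have 1: "gy + gx = - cell (1, 1) + (gx + gy)"
    by (simp only: cell_1_1 group_simps)
  have "gy + cls (letter_pow Lx (i + 1)) = gy + gx + ?x"
    by (simp add: cls_letter_pow_Suc add.assoc)
  also have "\<dots> = - cell (1, 1) + (gx + (gy + ?x))"
    unfolding 1 by (simp add: add.assoc)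
  also have "\<dots> = - cell (1, 1) + (gconj gx (cells L) + gx + ?x + gy)"
    unfolding L gconj_def by (simp add: add.assoc)
  also have "\<dots> = cells (((1, 1), False) # M) + (cls (letter_pow Lx (i + 1)) + gy)"
    unfolding M by (simp add: cls_letter_pow_Suc add.assoc)
  finally show ?case by blast
next
  case (step2 i)
  let ?x = "cls (letter_pow Lx (i - 1))"
  have x: "cls (letter_pow Lx i) = gx + ?x"
    using cls_letter_pow_Suc[of Lx "i - 1"] by simp
  obtain L where L: "gy + (gx + ?x) = cells L + (gx + ?x + gy)"
    using step2 x by auto
  have 1: "gx + gy = cell (1, 1) + (gy + gx)"
    by (simp only: cell_1_1 group_simps)
  obtain M where M: "gconj (- gx) (cells (((1, 1), True) # L)) = cells M"
    using gconj_uminus_letter_cells by blast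
  have "gx + (gy + ?x) = cells (((1, 1), True) # L) + (gx + ?x + gy)"
    using 1 L by (simp add: add.assoc[symmetric]) (simp add: add.assoc)
  then have "- gx + (gx + (gy + ?x)) = gconj (- gx) (cells (((1, 1), True) # L)) + - gx + (gx + ?x + gy)"
    by (simp only: gconj_def group_simps)
  then have "gy + ?x = cells M + (?x + gy)"
    unfolding M by (simp only: group_simps)
  then show ?case by blast
qed

lemma gy_uminus_gx_pow_cells:
  "\<exists>L. - gy + cls (letter_pow Lx i) = cells L + (cls (letter_pow Lx i) + - gy)"
proof -
  let ?x = "cls (letter_pow Lx i)"
  obtain L where L: "gy + ?x = cells L + (?x + gy)" using gy_pow_gx_cells by blast
  obtain M where M: "- cells L = cells M" using uminus_cells by blast
  obtain N where N: "gconj (- gy) (cells M) = cells N" using gconj_uminus_letter_cells by blast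
  have "?x + gy = cells M + (gy + ?x)"
    unfolding L M[symmetric] by (simp add: add.assoc)
  then have "- gy + (?x + gy + - gy) = - gy + (cells M + (gy + ?x) + - gy)"
    by simp
  then have "- gy + ?x = gconj (- gy) (cells M) + (?x + - gy)"
    unfolding gconj_def by (simp only: group_simps)
  then show ?thesis using N by metis
qed

text \<open>Collection from the left: a new first letter shifts the cells already collected, and
  then only this letter has to be merged into \<open>x^i y^j\<close>.\<close>

lemma cells_normal_form: "\<exists>L. cls w = cells L + cls (xy (pos w))"
proof (induction w)
  case Nil
  then show ?case by (auto simp: xy_def intro: exI[of _ "[]"])
next
  case (Cons l w)
  then obtain L where L: "cls w = cells L + cls (xy (pos w))" by blast
  obtain M where M: "gconj (cls [l]) (cells L) = cells M" using gconj_letter_cells by blast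
  obtain i j where ij: "pos w = (i, j)" by force
  have 1: "cls (l # w) = cells M + (cls [l] + cls (xy (i, j)))"
    unfolding cls_Cons[of l w] L M[symmetric] gconj_def ij by (simp only: group_simps)
  have y: "cls (letter_pow l (j - 1)) = - cls [l] + cls (letter_pow l j)" for l j
    using cls_letter_pow_Suc[of l "j - 1"] by (simp add: add.assoc[symmetric])
  have "\<exists>N. cls [l] + cls (xy (i, j)) = cells N + cls (xy (pos (l # w)))"
  proof (cases l)
    case Lx
    then show ?thesis
      by (intro exI[of _ "[]"]) (simp add: xy_def ij cls_letter_pow_Suc add.assoc add.commute[of 1 i])
  next
    case LxI
    then show ?thesis using y[of Lx i] cls_inv_letter[of Lx]
      by (intro exI[of _ "[]"]) (simp add: xy_def ij add.assoc)
  next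
    case Ly
    obtain N where "gy + cls (letter_pow Lx i) = cells N + (cls (letter_pow Lx i) + gy)"
      using gy_pow_gx_cells by blast
    then have "gy + cls (letter_pow Lx i) + cls (letter_pow Ly j) =
        cells N + cls (letter_pow Lx i) + (gy + cls (letter_pow Ly j))"
      by (simp add: add.assoc)
    then show ?thesis using Ly
      by (intro exI[of _ N]) (simp add: xy_def ij cls_letter_pow_Suc add.assoc add.commute[of 1 j])
  next
    case LyI
    obtain N where "- gy + cls (letter_pow Lx i) = cells N + (cls (letter_pow Lx i) + - gy)"
      using gy_uminus_gx_pow_cells by blast
    then have "- gy + cls (letter_pow Lx i) + cls (letter_pow Ly j) =
        cells N + cls (letter_pow Lx i) + (- gy + cls (letter_pow Ly j))"
      by (simp only: group_simps)
    then show ?thesis using LyI y[of Ly j] cls_inv_letter[of Ly]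
      by (intro exI[of _ N]) (simp add: xy_def ij add.assoc)
  qed
  then obtain N where "cls [l] + cls (xy (i, j)) = cells N + cls (xy (pos (l # w)))" by blast
  then have "cls (l # w) = cells (M @ N) + cls (xy (pos (l # w)))"
    using 1 by (simp add: add.assoc)
  then show ?case by blast
qed

section \<open>The flow determines the cells\<close>

definition mult :: "((int \<times> int) \<times> bool) list \<Rightarrow> int \<times> int \<Rightarrow> int" where
  "mult L q = sum_list (map (\<lambda>(p, s). if p = q then if s then 1 else - 1 else 0) L)"

lemma cell_commute: "cell p + cell q = cell q + cell p"
  using cell_gcomm[of p] cell_gcomm[of q] gcomm_commute by metis

lemma commute_uminus:
  fixes a b :: "'a::group_add"
  assumes "a + b = b + a" shows "a + - b = - b + a"
  by (metis add.assoc add.right_inverse add.right_neutral add.left_neutral left_minus assms)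

lemma cells_commute:
  assumes "a = cell p \<or> a = - cell p"
  shows "a + cells L = cells L + a"
proof (induction L)
  case (Cons c L)
  obtain q s where c: "c = (q, s)" by (cases c)
  have 1: "a + b = b + a" if "b = cell q \<or> b = - cell q" for b
    using assms that cell_commute[of p q] commute_uminus[of "cell p" "cell q"]
      commute_uminus[of "cell q" "cell p"] commute_uminus[of "- cell p" "cell q"]
    by metis
  show ?case using Cons 1 unfolding c
    by (simp del: add_uminus_conv_diff) (metis add.assoc)
qed simp

text \<open>The first factor has an inverse partner further on; since cells commute, the pair can be
  brought together and cancelled, leaving a shorter product.\<close>

lemma cells_eq_0: "(\<And>q. mult L q = 0) \<Longrightarrow> cells L = 0"
proof (induction L rule: length_induct)
  case (1 L)
  show ?case
  proof (cases L)
    case (Cons c L')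
    obtain p s where c: "c = (p, s)" by (cases c)
    \<comment> \<open>Without a partner all factors at \<open>p\<close> would have the same sign,
      and their exponents could not add up to 0.\<close>
    have "(p, \<not> s) \<in> set L'"
    proof (rule ccontr)
      assume "(p, \<not> s) \<notin> set L'"
      then have "s \<Longrightarrow> mult L' p \<ge> 0" "\<not> s \<Longrightarrow> mult L' p \<le> 0"
        unfolding mult_def by (auto intro!: sum_list_nonneg sum_list_nonpos)
      then show False using 1(2)[of p] Cons c by (auto simp: mult_def split: if_splits)
    qed
    then obtain A B where L': "L' = A @ (p, \<not> s) # B" by (meson split_list)
    have "mult (A @ B) q = 0" for q
      using 1(2)[of q] unfolding Cons c L' by (auto simp: mult_def split: if_splits)
    then have 0: "cells (A @ B) = 0"
      using 1(1)[rule_format, of "A @ B"] Cons L' by simp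
    let ?a = "if s then cell p else - cell p"
    have "?a + cells A = cells A + ?a" by (rule cells_commute[of _ p]) auto
    then have "?a + cells A + (- ?a + cells B) = cells A + cells B"
      by (simp only: group_simps)
    then show ?thesis using 0 unfolding Cons c L'
      by (cases s) (simp_all add: add.assoc del: add_uminus_conv_diff)
  qed simp
qed

definition cell_word :: "int \<times> int \<Rightarrow> word" where
  "cell_word p = xy p @ comm [Lx] [Ly] @ inv_word (xy p)"

lemma cls_cell_word: "cls (cell_word p) = cell p"
  by (simp only: cell_word_def cell_def gconj_def gcomm_def comm_def cls_simps group_simps)

lemma pos_cell_word [simp]: "pos (cell_word p) = 0"
  by (simp add: cell_word_def comm_def zero_prod_def)

lemma flow_cell_word:
  "flow (cell_word p) q = of_bool (p = q + (0, 1)) - of_bool (p = q + (1, 1))"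
  by (cases p; cases q) (auto simp: cell_word_def flow_inv_word comm_def zero_prod_def)

lemma cells_word: "\<exists>w. cls w = cells L \<and> pos w = 0 \<and>
    (\<forall>q. flow w q = mult L (q + (0, 1)) - mult L (q + (1, 1)))"
proof (induction L)
  case Nil
  then show ?case by (intro exI[of _ "[]"]) (auto simp: mult_def)
next
  case (Cons c L)
  obtain p s where c: "c = (p, s)" by (cases c)
  from Cons obtain w where w: "cls w = cells L" "pos w = 0"
    "\<And>q. flow w q = mult L (q + (0, 1)) - mult L (q + (1, 1))" by blast
  let ?c = "if s then cell_word p else inv_word (cell_word p)"
  have "flow (?c @ w) q = mult (c # L) (q + (0, 1)) - mult (c # L) (q + (1, 1))" for q
    by (auto simp: flow_inv_word flow_cell_word w(2,3) mult_def c)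
  then show ?case
    by (intro exI[of _ "?c @ w"]) (auto simp: w c cls_cell_word)
qed

lemma finite_mult: "finite {q. mult L q \<noteq> 0}"
proof (rule finite_subset)
  have "mult L q = 0" if "q \<notin> fst ` set L" for q
    using that by (induction L) (auto simp: mult_def)
  then show "{q. mult L q \<noteq> 0} \<subseteq> fst ` set L" by blast
qed simp

text \<open>For the converse it suffices to treat the closed word \<open>u @ inv_word v\<close>, a
  product of cells. Its flow is the horizontal difference of \<open>mult\<close>, so zero flow makes
  \<open>mult\<close> constant along rows, and finite support makes it zero.\<close>

lemma meq_iff: "meq u v \<longleftrightarrow> pos u = pos v \<and> flow u = flow v"
proof
  assume uv: "pos u = pos v \<and> flow u = flow v"
  let ?w = "u @ inv_word v"
  obtain L where L: "cls ?w = cells L + cls (xy (pos ?w))" using cells_normal_form by blast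
  then have L': "cls ?w = cells L" using uv by (simp add: xy_def)
  obtain w where w: "cls w = cells L" "\<And>q. flow w q = mult L (q + (0, 1)) - mult L (q + (1, 1))"
    using cells_word by blast
  have "flow w = flow ?w" using w(1) L' by (metis cls_eq_iff meq_pos_flow)
  moreover have "flow ?w q = 0" for q using uv by (simp add: flow_inv_word)
  ultimately have *: "mult L (q + (0, 1)) = mult L (q + (1, 1))" for q using w(2)[of q] by simp
  have step: "mult L (i, j) = mult L (i + 1, j)" for i j using *[of "(i, j - 1)"] by simp
  have step_n: "mult L (i, j) = mult L (i + int n, j)" for i j n
  proof (induction n)
    case (Suc n)
    then show ?case using step[of "i + int n" j] by (simp add: algebra_simps)
  qed simp
  have "mult L (i, j) = 0" for i j
  proof (rule ccontr)
    assume "mult L (i, j) \<noteq> 0"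
    then have "range (\<lambda>n. (i + int n, j)) \<subseteq> {q. mult L q \<noteq> 0}" using step_n by auto
    moreover have "infinite (range (\<lambda>n. (i + int n, j)))"
      by (intro range_inj_infinite injI) auto
    ultimately show False using finite_mult finite_subset by blast
  qed
  then have "cells L = 0" by (intro cells_eq_0) auto
  then show "meq u v" using L' by (simp add: cls_eq_iff[symmetric])
qed (rule meq_pos_flow)

section \<open>Linear systems over the grid\<close>

type_synonym 'u equation = "(int \<times> (int \<times> int) \<times> 'u) list"

text \<open>Coefficients of the Laurent polynomial obtained by summing
  \<open>k * X^i * Y^j * c u\<close> over the entries, where \<open>d = (i, j)\<close>. Thus an
  equation is linear over the integral group ring of the grid, with unknowns having natural
  coefficients.\<close>

definition lhs :: "'u equation \<Rightarrow> ('u \<Rightarrow> int \<times> int \<Rightarrow> nat) \<Rightarrow> int \<times> int \<Rightarrow> int" where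
  "lhs e c p = (\<Sum>(k, d, u)\<leftarrow>e. k * int (c u (p - d)))"

definition lattice :: "nat \<Rightarrow> int \<times> int \<Rightarrow> int \<times> int" where
  "lattice m d = (int m * fst d, snd d)"

definition at_lattice :: "nat \<Rightarrow> int \<times> int \<Rightarrow> word \<Rightarrow> word" where
  "at_lattice m d w = xy (lattice m d) @ w @ inv_word (xy (lattice m d))"

text \<open>One upward crossing in column \<open>j + 1\<close>, paid for by a downward one in column
  0. Equation \<open>j\<close> is read off in the columns congruent to \<open>j + 1\<close>, so
  \<open>m\<close> is one more than the number of equations.\<close>

definition basis_word :: "nat \<Rightarrow> word" where
  "basis_word j = replicate (Suc j) Lx @ [Ly] @ replicate (Suc j) LxI @ [LyI]"

definition word_pow :: "word \<Rightarrow> int \<Rightarrow> word" where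
  "word_pow w k = concat (replicate (nat \<bar>k\<bar>) (if k \<ge> 0 then w else inv_word w))"

type_synonym item = "nat \<times> int \<times> (int \<times> int)"

definition item_word :: "nat \<Rightarrow> item \<Rightarrow> word" where
  "item_word m = (\<lambda>(j, k, d). at_lattice m d (word_pow (basis_word j) k))"

definition items_word :: "nat \<Rightarrow> item list \<Rightarrow> word" where
  "items_word m I = concat (map (item_word m) I)"

definition item_coeff :: "item list \<Rightarrow> nat \<Rightarrow> int \<times> int \<Rightarrow> int" where
  "item_coeff I j p = (\<Sum>(i, k, d)\<leftarrow>I. if i = j \<and> d = p then k else 0)"

lemma flow_replicate_horizontal [simp]:
  "flow (replicate n Lx) p = 0" "flow (replicate n LxI) p = 0"
  by (induction n arbitrary: p) auto

lemma pos_basis_word [simp]: "pos (basis_word j) = 0"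
  by (simp add: basis_word_def pos_replicate zero_prod_def)

lemma flow_basis_word:
  "flow (basis_word j) p = of_bool (p = (int (Suc j), 0)) - of_bool (p = (0, 0))"
  by (cases p) (auto simp: basis_word_def pos_replicate)

lemma word_pow_pos_flow:
  assumes "pos w = 0"
  shows "pos (word_pow w k) = 0" "flow (word_pow w k) p = k * flow w p"
proof -
  have *: "pos (concat (replicate n v)) = 0 \<and> flow (concat (replicate n v)) p = int n * flow v p"
    if "pos v = 0" for n v
    using that by (induction n) (auto simp: algebra_simps)
  show "pos (word_pow w k) = 0" "flow (word_pow w k) p = k * flow w p"
    using *[of w "nat \<bar>k\<bar>"] *[of "inv_word w" "nat \<bar>k\<bar>"] assms
    by (auto simp: word_pow_def flow_inv_word)
qed

lemma pos_at_lattice [simp]: "pos w = 0 \<Longrightarrow> pos (at_lattice m d w) = 0"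
  by (simp add: at_lattice_def)

lemma flow_at_lattice: "pos w = 0 \<Longrightarrow> flow (at_lattice m d w) p = flow w (p - lattice m d)"
  by (simp add: at_lattice_def flow_inv_word)

lemma pos_item_word [simp]: "pos (item_word m i) = 0"
  by (auto simp: item_word_def word_pow_pos_flow split: prod.splits)

lemma pos_items_word [simp]: "pos (items_word m I) = 0"
  by (induction I) (auto simp: items_word_def)

lemma residue_unique:
  assumes "int m * a + int r = int m * b + int s" "r < m" "s < m"
  shows "a = b \<and> r = s"
proof -
  have "(int m * a + int r) mod int m = int r" "(int m * b + int s) mod int m = int s"
    using assms(2,3) by auto
  then have "r = s" using assms(1) by simp
  then show ?thesis using assms by auto
qed

lemma flow_item_word:
  assumes "Suc j < m" "r < m"
  shows "flow (item_word m (j, k, d)) (int m * a + int r, b) =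
    (if d = (a, b) then if r = 0 then - k else if r = Suc j then k else 0 else 0)"
proof -
  have 1: "(int m * a + int r, b) - lattice m d = (int (Suc j), 0) \<longleftrightarrow> d = (a, b) \<and> r = Suc j"
    using residue_unique[of m a r "fst d" "Suc j"] assms
    by (cases d) (auto simp: lattice_def algebra_simps)
  have 2: "(int m * a + int r, b) - lattice m d = (0, 0) \<longleftrightarrow> d = (a, b) \<and> r = 0"
    using residue_unique[of m a r "fst d" 0] assms
    by (cases d) (auto simp: lattice_def algebra_simps)
  show ?thesis
    unfolding item_word_def
    by (simp add: flow_at_lattice word_pow_pos_flow flow_basis_word 1 2 del: of_nat_Suc diff_Pair)
qed

text \<open>Off the columns divisible by \<open>m\<close> the flow reads off the coefficients; the columns
  divisible by \<open>m\<close> only serve to close up the words.\<close>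

lemma flow_items_word:
  assumes "\<forall>(j, k, d)\<in>set I. Suc j < m" "r < m"
  shows "flow (items_word m I) (int m * a + int r, b) =
    (if r = 0 then - (\<Sum>j<m - 1. item_coeff I j (a, b)) else item_coeff I (r - 1) (a, b))"
  using assms(1)
proof (induction I)
  case Nil
  then show ?case by (simp add: items_word_def item_coeff_def)
next
  case (Cons i I)
  obtain j k d where i: "i = (j, k, d)" by (cases i)
  have j: "Suc j < m" using Cons i by auto
  have "flow (items_word m (i # I)) p = flow (item_word m i) p + flow (items_word m I) p" for p
    by (simp add: items_word_def)
  moreover have "item_coeff (i # I) l p = (if j = l \<and> d = p then k else 0) + item_coeff I l p" for l p
    by (simp add: item_coeff_def i)
  moreover have "(\<Sum>l<m - 1. if j = l \<and> d = (a, b) then k else 0) = (if d = (a, b) then k else 0)"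
    using j by (simp add: sum.delta' if_distrib conj_commute cong: if_cong)
       (auto simp: sum.delta)
  ultimately show ?case
    using Cons flow_item_word[OF j assms(2), of k d a b] unfolding i
    by (auto simp: sum.distrib)
qed

text \<open>Transposes the system: the word of the unknown \<open>u\<close> carries every
  coefficient with which \<open>u\<close> occurs, each in the column class of its equation.\<close>

definition items_of :: "'u equation list \<Rightarrow> 'u \<Rightarrow> item list" where
  "items_of Es u = concat (map (\<lambda>j. map (\<lambda>(k, d, v). (j, k, d))
     (filter (\<lambda>(k, d, v). v = u) (Es ! j))) [0..<length Es])"

lemma items_of_index: "\<forall>(j, k, d)\<in>set (items_of Es u). Suc j < Suc (length Es)"
  by (auto simp: items_of_def)

lemma item_coeff_items_of:
  assumes "j < length Es"
  shows "item_coeff (items_of Es u) j p = (\<Sum>(k, d, v)\<leftarrow>Es ! j. if v = u \<and> d = p then k else 0)"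
proof -
  have *: "item_coeff (map (\<lambda>(k, d, v). (i, k, d)) (filter (\<lambda>(k, d, v). v = u) e)) j p =
     (if i = j then (\<Sum>(k, d, v)\<leftarrow>e. if v = u \<and> d = p then k else 0) else 0)" for i and e :: "'a equation"
    by (induction e) (auto simp: item_coeff_def)
  have append: "item_coeff (A @ B) j p = item_coeff A j p + item_coeff B j p" for A B
    by (simp add: item_coeff_def)
  have "item_coeff (concat (map (\<lambda>j. map (\<lambda>(k, d, v). (j, k, d))
     (filter (\<lambda>(k, d, v). v = u) (Es ! j))) [0..<n])) j p =
     (if j < n then (\<Sum>(k, d, v)\<leftarrow>Es ! j. if v = u \<and> d = p then k else 0) else 0)" for n
    by (induction n) (auto simp: append *, auto simp: item_coeff_def)
  then show ?thesis using assms by (simp add: items_of_def)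
qed

definition unknowns :: "'u equation list \<Rightarrow> 'u list" where
  "unknowns Es = concat (map (map (\<lambda>(k, d, u). u)) Es)"

definition system_gens :: "'u equation list \<Rightarrow> word list" where
  "system_gens Es = (let m = Suc (length Es) in
     [replicate m Lx, replicate m LxI, [Ly], [LyI]] @ map (\<lambda>u. items_word m (items_of Es u)) (unknowns Es))"

text \<open>Passes from a list of placed copies of the unknowns to multiplicities, which is where
  the natural numbers enter.\<close>

lemma sum_list_shift_count:
  "(\<Sum>(u, d)\<leftarrow>L. \<Sum>(k, d', v)\<leftarrow>e. if v = u \<and> d' = p - d then k else 0) =
    lhs e (\<lambda>u d. count_list L (u, d)) p"
proof (induction L)
  case Nil
  have "lhs e (\<lambda>u d. 0) p = 0" by (induction e) (auto simp: lhs_def)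
  then show ?case by simp
next
  case (Cons x L)
  obtain u d where x: "x = (u, d)" by (cases x)
  have "lhs e (\<lambda>u d. count_list (x # L) (u, d)) p =
      (\<Sum>(k, d', v)\<leftarrow>e. if v = u \<and> d' = p - d then k else 0) + lhs e (\<lambda>u d. count_list L (u, d)) p"
  proof (induction e)
    case (Cons y e)
    obtain k d' v where y: "y = (k, d', v)" by (cases y)
    have "p - d' = d \<longleftrightarrow> d' = p - d" by (auto simp: algebra_simps)
    then show ?case using Cons by (auto simp: lhs_def x y algebra_simps)
  qed (simp add: lhs_def)
  then show ?case using Cons x by simp
qed

lemma count_list_exists:
  assumes "finite {x. f x \<noteq> 0}" shows "\<exists>L. \<forall>x. count_list L x = (f x :: nat)"
proof -
  have "count (Abs_multiset f) = f"
    using assms by (intro Abs_multiset_inverse) simp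
  moreover obtain L where "mset L = Abs_multiset f" using ex_mset by blast
  ultimately show ?thesis by (metis count_mset)
qed

text \<open>\<open>L\<close> records which words of unknowns are read and at which lattice point
  each reading begins. The order is immaterial since these words are closed and their flows add
  up.\<close>

lemma submonoid_word_flow:
  assumes "set ks \<subseteq> set (system_gens Es)"
  defines "m \<equiv> Suc (length Es)"
  shows "\<exists>L a0 b0. pos (concat ks) = (int m * a0, b0) \<and>
    (\<forall>j<length Es. \<forall>a b. flow (concat ks) (int m * a + int (Suc j), b) =
       (\<Sum>(u, d)\<leftarrow>L. item_coeff (items_of Es u) j ((a, b) - d)))"
  using assms(1)
proof (induction ks)
  case Nil
  show ?case by (intro exI[of _ "[]"] exI[of _ 0]) (simp add: zero_prod_def)
next
  case (Cons k ks)
  from Cons(2) have "set ks \<subseteq> set (system_gens Es)" by simp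
  from Cons(1)[OF this] obtain L a0 b0 where L: "pos (concat ks) = (int m * a0, b0)"
    "\<And>j a b. j < length Es \<Longrightarrow> flow (concat ks) (int m * a + int (Suc j), b) =
       (\<Sum>(u, d)\<leftarrow>L. item_coeff (items_of Es u) j ((a, b) - d))" by blast
  \<comment> \<open>A generator of the lattice contributes nothing to the relevant columns; it only
    translates everything read after it.\<close>
  have move: ?case if k: "pos k = (int m * x, y)"
    and flow: "\<And>j a b. j < length Es \<Longrightarrow> flow k (int m * a + int (Suc j), b) = 0" for x y
  proof (intro exI conjI allI impI)
    let ?M = "map (\<lambda>(u, d). (u, d + (x, y))) L"
    show "pos (concat (k # ks)) = (int m * (x + a0), y + b0)"
      using L(1) k by (simp add: algebra_simps)
    fix j a b assume j: "j < length Es"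
    have "(int m * a + int (Suc j), b) - pos k = (int m * (a - x) + int (Suc j), b - y)"
      using k by (simp add: algebra_simps)
    then have "flow (concat (k # ks)) (int m * a + int (Suc j), b) =
        (\<Sum>(u, d)\<leftarrow>L. item_coeff (items_of Es u) j ((a - x, b - y) - d))"
      using L(2)[OF j, of "a - x" "b - y"] flow[OF j, of a b] by (simp del: of_nat_Suc)
    also have "\<dots> = (\<Sum>(u, d)\<leftarrow>?M. item_coeff (items_of Es u) j ((a, b) - d))"
      by (induction L) (auto simp: algebra_simps)
    finally show "flow (concat (k # ks)) (int m * a + int (Suc j), b) =
      (\<Sum>(u, d)\<leftarrow>?M. item_coeff (items_of Es u) j ((a, b) - d))" .
  qed
  have nonzero: "int m * a + int (Suc j) \<noteq> 0" if "j < length Es" for a j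
    using residue_unique[of m a "Suc j" 0 0] that by (auto simp: m_def)
  consider "k = replicate m Lx" | "k = replicate m LxI" | "k = [Ly]" | "k = [LyI]"
    | u where "k = items_word m (items_of Es u)"
    using Cons(2) unfolding system_gens_def m_def Let_def by auto
  then show ?case
  proof cases
    case 1
    then show ?thesis by (intro move[of 1 0]) (auto simp: pos_replicate)
  next
    case 2
    then show ?thesis by (intro move[of "-1" 0]) (auto simp: pos_replicate)
  next
    case 3
    then show ?thesis using nonzero by (intro move[of 0 1]) (auto simp del: of_nat_Suc)
  next
    case 4
    then show ?thesis using nonzero by (intro move[of 0 "-1"]) (auto simp del: of_nat_Suc)
  next
    case 5
    show ?thesis
    proof (intro exI conjI allI impI)
      show "pos (concat (k # ks)) = (int m * a0, b0)" using L(1) 5 by simp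
      fix j a b assume j: "j < length Es"
      have "flow k (int m * a + int (Suc j), b) = item_coeff (items_of Es u) j (a, b)"
        unfolding 5 using flow_items_word[of "items_of Es u" m "Suc j" a b] items_of_index[of Es u] j
        by (simp add: m_def)
      then show "flow (concat (k # ks)) (int m * a + int (Suc j), b) =
          (\<Sum>(u, d)\<leftarrow>(u, (0, 0)) # L. item_coeff (items_of Es u) j ((a, b) - d))"
        using L(2)[OF j, of a b] 5 by (simp del: of_nat_Suc)
    qed
  qed
qed

lemma inv_word_letter_pow: "inv_word (letter_pow l z) = letter_pow l (- z)"
  by (cases "z = 0") (auto simp: letter_pow_def inv_word_def)

definition factors :: "word list \<Rightarrow> word \<Rightarrow> bool" where
  "factors gens w \<longleftrightarrow> (\<exists>ks. set ks \<subseteq> set gens \<and> w = concat ks)"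

lemma factors_Nil: "factors gens []"
  unfolding factors_def by (intro exI[of _ "[]"]) auto

lemma factors_gen: "w \<in> set gens \<Longrightarrow> factors gens w"
  unfolding factors_def by (intro exI[of _ "[w]"]) auto

lemma factors_append: "factors gens u \<Longrightarrow> factors gens v \<Longrightarrow> factors gens (u @ v)"
  unfolding factors_def by (metis concat_append set_append Un_least)

lemma factors_concat: "(\<And>w. w \<in> set ws \<Longrightarrow> factors gens w) \<Longrightarrow> factors gens (concat ws)"
  by (induction ws) (auto intro: factors_append factors_Nil)

lemma factors_lattice:
  fixes Es :: "'u equation list"
  defines "m \<equiv> Suc (length Es)"
  shows "factors (system_gens Es) (letter_pow Lx (int m * z))" "factors (system_gens Es) (letter_pow Ly z)"
proof -
  have rep: "replicate (m * n) l = concat (replicate n (replicate m l))" for n and l :: letter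
    by (induction n) (auto simp: replicate_add)
  have rep1: "replicate n l = concat (replicate n [l])" for n and l :: letter
    by (induction n) auto
  have nat: "nat (int m * z) = m * nat z" "nat (- (int m * z)) = m * nat (- z)"
    by (simp add: nat_mult_distrib) (metis mult_minus_right nat_int nat_mult_distrib of_nat_0_le_iff)
  have x: "factors (system_gens Es) (replicate (m * n) l)" if "l = Lx \<or> l = LxI" for n l
    unfolding rep using that
    by (intro factors_concat factors_gen) (auto simp: system_gens_def Let_def m_def)
  have y: "factors (system_gens Es) (replicate n l)" if "l = Ly \<or> l = LyI" for n l
    unfolding rep1 using that
    by (intro factors_concat factors_gen) (auto simp: system_gens_def Let_def)
  show "factors (system_gens Es) (letter_pow Lx (int m * z))"
    unfolding letter_pow_def nat using x by simp
  show "factors (system_gens Es) (letter_pow Ly z)"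
    unfolding letter_pow_def using y by simp
qed

lemma factors_at_lattice:
  assumes "factors (system_gens Es) w"
  shows "factors (system_gens Es) (at_lattice (Suc (length Es)) d w)"
proof -
  let ?m = "Suc (length Es)"
  have "inv_word (xy (lattice ?m d)) = letter_pow Ly (- snd d) @ letter_pow Lx (int ?m * - fst d)"
    by (simp add: xy_def lattice_def inv_word_letter_pow)
  moreover have "xy (lattice ?m d) = letter_pow Lx (int ?m * fst d) @ letter_pow Ly (snd d)"
    by (simp add: xy_def lattice_def)
  ultimately show ?thesis unfolding at_lattice_def
    by (simp only:) (intro factors_append factors_lattice assms)
qed

lemma pos_flow_concat:
  assumes "\<And>u. pos (g u) = 0"
  shows "pos (concat (map (\<lambda>(u, d). at_lattice m d (g u)) L)) = 0"
    "flow (concat (map (\<lambda>(u, d). at_lattice m d (g u)) L)) p = (\<Sum>(u, d)\<leftarrow>L. flow (g u) (p - lattice m d))"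
  using assms by (induction L) (auto simp: flow_at_lattice)

text \<open>From a factorisation, count how often each word of an unknown is read at each place.
  Conversely, from a solution, put as many conjugated copies at each lattice point as it prescribes.
  The result is closed, and the columns divisible by \<open>m\<close> need no equation: in each row
  their flow is minus the sum of the others in the same block of \<open>m\<close> columns.\<close>

theorem in_submonoid_system_iff:
  fixes Es :: "'u equation list"
  defines "m \<equiv> Suc (length Es)"
  assumes I: "\<forall>(j, k, d)\<in>set I. j < length Es"
  shows "in_submonoid (system_gens Es) (items_word m I) \<longleftrightarrow>
    (\<exists>c. (\<forall>u. finite {p. c u p \<noteq> 0}) \<and>
      (\<forall>j<length Es. \<forall>p. lhs (Es ! j) c p = item_coeff I j p))"
proof
  assume "in_submonoid (system_gens Es) (items_word m I)"
  then obtain ks where ks: "set ks \<subseteq> set (system_gens Es)" "meq (items_word m I) (concat ks)"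
    unfolding in_submonoid_def by blast
  obtain L where L: "\<And>j a b. j < length Es \<Longrightarrow> flow (concat ks) (int m * a + int (Suc j), b) =
       (\<Sum>(u, d)\<leftarrow>L. item_coeff (items_of Es u) j ((a, b) - d))"
    using submonoid_word_flow[OF ks(1)] unfolding m_def by blast
  let ?c = "\<lambda>u d. count_list L (u, d)"
  show "\<exists>c. (\<forall>u. finite {p. c u p \<noteq> 0}) \<and> (\<forall>j<length Es. \<forall>p. lhs (Es ! j) c p = item_coeff I j p)"
  proof (intro exI[of _ ?c] conjI allI impI)
    fix u
    have "{p. ?c u p \<noteq> 0} \<subseteq> snd ` set L"
    proof
      fix p :: "int \<times> int" assume "p \<in> {p. ?c u p \<noteq> 0}"
      then have "(u, p) \<in> set L" using count_notin by fastforce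
      then show "p \<in> snd ` set L" by force
    qed
    then show "finite {p. ?c u p \<noteq> 0}" by (rule finite_subset) simp
  next
    fix j and p :: "int \<times> int" assume j: "j < length Es"
    obtain a b where p: "p = (a, b)" by force
    have "item_coeff I j p = flow (items_word m I) (int m * a + int (Suc j), b)"
      using flow_items_word[of I m "Suc j" a b] I j p by (auto simp: m_def)
    also have "\<dots> = flow (concat ks) (int m * a + int (Suc j), b)"
      using ks(2) by (simp add: meq_iff)
    also have "\<dots> = lhs (Es ! j) ?c p"
      using L[OF j, of a b] item_coeff_items_of[OF j] sum_list_shift_count[where e = "Es ! j" and p = p and L = L] p by simp
    finally show "lhs (Es ! j) ?c p = item_coeff I j p" by simp
  qed
next
  assume "\<exists>c. (\<forall>u. finite {p. c u p \<noteq> 0}) \<and>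
      (\<forall>j<length Es. \<forall>p. lhs (Es ! j) c p = item_coeff I j p)"
  then obtain c where c: "\<And>u. finite {p. c u p \<noteq> 0}"
    "\<And>j p. j < length Es \<Longrightarrow> lhs (Es ! j) c p = item_coeff I j p" by blast
  \<comment> \<open>The restriction to unknowns that occur makes the total support finite;
    finiteness was only assumed for each unknown separately.\<close>
  let ?f = "\<lambda>(u, d). if u \<in> set (unknowns Es) then c u d else 0"
  have "{x. ?f x \<noteq> 0} \<subseteq> Sigma (set (unknowns Es)) (\<lambda>u. {p. c u p \<noteq> 0})"
    by (auto split: if_splits)
  then have "finite {x. ?f x \<noteq> 0}" by (rule finite_subset) (intro finite_SigmaI c; simp)
  then obtain L where L: "\<And>x. count_list L x = ?f x" using count_list_exists[of ?f] by blast
  have L_unknowns: "u \<in> set (unknowns Es)" if "(u, d) \<in> set L" for u d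
    using L[of "(u, d)"] that by (auto simp: count_list_0_iff split: if_splits)
  have lhs_L: "lhs (Es ! j) (\<lambda>u d. count_list L (u, d)) p = item_coeff I j p" if j: "j < length Es" for j p
  proof -
    have "u \<in> set (unknowns Es)" if "(k, d, u) \<in> set (Es ! j)" for k d u
      using that j unfolding unknowns_def by (force intro: nth_mem)
    then have "lhs (Es ! j) (\<lambda>u d. count_list L (u, d)) p = lhs (Es ! j) c p"
      unfolding lhs_def L by (intro arg_cong[where f = sum_list] map_cong) auto
    then show ?thesis using c(2)[OF j] by simp
  qed
  let ?g = "\<lambda>u. items_word m (items_of Es u)"
  let ?W = "concat (map (\<lambda>(u, d). at_lattice m d (?g u)) L)"
  have factors: "factors (system_gens Es) ?W"
  proof (rule factors_concat)
    fix w assume "w \<in> set (map (\<lambda>(u, d). at_lattice m d (?g u)) L)"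
    then obtain u d where ud: "(u, d) \<in> set L" "w = at_lattice m d (?g u)" by auto
    then show "factors (system_gens Es) w" using L_unknowns[OF ud(1)] unfolding m_def ud(2)
      by (intro factors_at_lattice factors_gen) (auto simp: system_gens_def Let_def)
  qed
  have meq: "meq (items_word m I) ?W"
    unfolding meq_iff
  proof (intro conjI ext)
    show "pos (items_word m I) = pos ?W" by (simp add: pos_flow_concat)
    fix p :: "int \<times> int"
    obtain x b where p: "p = (x, b)" by force
    define a r where "a = x div int m" and "r = nat (x mod int m)"
    have x: "x = int m * a + int r" and r: "r < m"
      by (auto simp: a_def r_def m_def nat_less_iff)
    have I': "\<forall>(j, k, d)\<in>set I. Suc j < m" using I by (auto simp: m_def)
    have g: "flow (?g u) (p - lattice m d) =
      (if r = 0 then - (\<Sum>j<m - 1. item_coeff (items_of Es u) j ((a, b) - d))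
       else item_coeff (items_of Es u) (r - 1) ((a, b) - d))" for u d
    proof -
      have "p - lattice m d = (int m * (a - fst d) + int r, b - snd d)"
        by (simp add: p x lattice_def algebra_simps)
      then show ?thesis
        using flow_items_word[of "items_of Es u" m r "a - fst d" "b - snd d"] items_of_index[of Es u] r
        by (cases d) (simp add: m_def)
    qed
    have S: "(\<Sum>(u, d)\<leftarrow>L. item_coeff (items_of Es u) j ((a, b) - d)) = item_coeff I j (a, b)"
      if "j < length Es" for j
      using lhs_L[OF that, of "(a, b)"] sum_list_shift_count[where e = "Es ! j" and p = "(a, b)" and L = L]
      by (simp add: item_coeff_items_of[OF that])
    have neg_sum: "(\<Sum>(u, d)\<leftarrow>M. - (\<Sum>j<k. F j u d)) = - (\<Sum>j<k. \<Sum>(u, d)\<leftarrow>M. F j u d)"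
      for F :: "nat \<Rightarrow> 'u \<Rightarrow> int \<times> int \<Rightarrow> int" and k M
      by (induction M) (auto simp: sum.distrib)
    have "flow ?W p = (if r = 0 then - (\<Sum>j<m - 1. item_coeff I j (a, b)) else item_coeff I (r - 1) (a, b))"
      unfolding pos_flow_concat(2)[OF pos_items_word] g using S r by (auto simp: neg_sum m_def)
    then show "flow (items_word m I) p = flow ?W p"
      using flow_items_word[OF I' r, of a b] by (simp add: p x)
  qed
  obtain ks where "set ks \<subseteq> set (system_gens Es)" "?W = concat ks"
    using factors unfolding factors_def by (elim exE conjE)
  then show "in_submonoid (system_gens Es) (items_word m I)"
    using meq unfolding in_submonoid_def by metis
qed

section \<open>Horn clauses as linear systems\<close>

datatype tm = Var nat | Num nat | Add tm tm | Mul tm tm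

primrec tm_val :: "(nat \<Rightarrow> nat) \<Rightarrow> tm \<Rightarrow> nat" where
  "tm_val \<sigma> (Var i) = \<sigma> i"
| "tm_val \<sigma> (Num k) = k"
| "tm_val \<sigma> (Add a b) = tm_val \<sigma> a + tm_val \<sigma> b"
| "tm_val \<sigma> (Mul a b) = tm_val \<sigma> a * tm_val \<sigma> b"

type_synonym rule = "tm \<times> tm list"

inductive derives :: "rule list \<Rightarrow> nat \<Rightarrow> bool" for R where
  derives_rule: "(c, ps) \<in> set R \<Longrightarrow> (\<And>p. p \<in> set ps \<Longrightarrow> derives R (tm_val \<sigma> p)) \<Longrightarrow> derives R (tm_val \<sigma> c)"

text \<open>Sums and products of the same arguments come in pairs, because a single equation
  (\<open>eq_node\<close> below) determines both.\<close>

primrec subterms :: "tm \<Rightarrow> tm list" where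
  "subterms (Var i) = [Var i]"
| "subterms (Num k) = [Num k]"
| "subterms (Add a b) = Add a b # Mul a b # subterms a @ subterms b"
| "subterms (Mul a b) = Add a b # Mul a b # subterms a @ subterms b"

primrec nodes :: "tm \<Rightarrow> (tm \<times> tm) list" where
  "nodes (Var i) = []"
| "nodes (Num k) = []"
| "nodes (Add a b) = (a, b) # nodes a @ nodes b"
| "nodes (Mul a b) = (a, b) # nodes a @ nodes b"

primrec nums :: "tm \<Rightarrow> nat list" where
  "nums (Var i) = []"
| "nums (Num k) = [k]"
| "nums (Add a b) = nums a @ nums b"
| "nums (Mul a b) = nums a @ nums b"

definition rule_terms :: "rule \<Rightarrow> tm list" where
  "rule_terms r = fst r # snd r"

text \<open>\<open>US r\<close> marks the columns in which rule \<open>r\<close> is applied, \<open>UV r x\<close> has there a token at the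
  value of \<open>x\<close>, and \<open>UQ r x\<close> is the quotient of their difference by \<open>Y - 1\<close>, which is nonnegative
  iff the value is. \<open>UWp r a b\<close> and \<open>UWn r a b\<close> are the positive and negative part of a multiple of
  \<open>(Y - 1)\<^sup>3\<close>, \<open>UE\<close> marks the end of the derivation, and \<open>UT\<close> counts the open obligations
  after each column.\<close>

datatype unk = US rule | UV rule tm | UQ rule tm | UWp rule tm tm | UWn rule tm tm | UE | UT

text \<open>Reads \<open>(1 - X) * S + E = 1\<close>, with \<open>S\<close> the sum of all
  \<open>US r\<close>.\<close>

definition eq_time :: "rule list \<Rightarrow> unk equation" where
  "eq_time R = concat (map (\<lambda>r. [(1, (0, 0), US r), (-1, (1, 0), US r)]) R) @ [(1, (0, 0), UE)]"

text \<open>A balance of obligations, \<open>(1 - X) * T + conclusions - premises = Y^n\<close>: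
  each application removes its conclusion and adds its premises.\<close>

definition eq_pending :: "rule list \<Rightarrow> unk equation" where
  "eq_pending R = [(1, (0, 0), UT), (-1, (1, 0), UT)] @
     concat (map (\<lambda>r. (1, (0, 0), UV r (fst r)) # map (\<lambda>p. (-1, (0, 0), UV r p)) (snd r)) R)"

definition eq_token :: "rule \<Rightarrow> tm \<Rightarrow> unk equation" where
  "eq_token r x = [(1, (0, 0), UV r x), (-1, (0, 0), US r), (-1, (0, 1), UQ r x), (1, (0, 0), UQ r x)]"

definition eq_num :: "rule \<Rightarrow> nat \<Rightarrow> unk equation" where
  "eq_num r k = [(1, (0, 0), UV r (Num k)), (-1, (0, int k), US r)]"

text \<open>With tokens in place this is
  \<open>(Y^a - 1)(Y^b - 1) - (Y - 1)(Y^(ab) - 1) = (Y - 1)^3 * W\<close>, where \<open>W\<close> is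
  the difference of \<open>UWp\<close> and \<open>UWn\<close>. The constants cancel, leaving the
  lone term \<open>Y\<close>, which is supplied by \<open>US r\<close> shifted up by one.\<close>

definition eq_node :: "rule \<Rightarrow> tm \<Rightarrow> tm \<Rightarrow> unk equation" where
  "eq_node r a b = [(1, (0, 0), UV r (Add a b)), (-1, (0, 0), UV r a), (-1, (0, 0), UV r b),
     (-1, (0, 1), UV r (Mul a b)), (1, (0, 0), UV r (Mul a b)), (1, (0, 1), US r),
     (-1, (0, 3), UWp r a b), (3, (0, 2), UWp r a b), (-3, (0, 1), UWp r a b), (1, (0, 0), UWp r a b),
     (1, (0, 3), UWn r a b), (-3, (0, 2), UWn r a b), (3, (0, 1), UWn r a b), (-1, (0, 0), UWn r a b)]"

definition local_eqs :: "rule \<Rightarrow> unk equation list" where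
  "local_eqs r = map (eq_token r) (concat (map subterms (rule_terms r))) @
     map (eq_num r) (concat (map nums (rule_terms r))) @
     map (\<lambda>(a, b). eq_node r a b) (concat (map nodes (rule_terms r)))"

definition horn_system :: "rule list \<Rightarrow> unk equation list" where
  "horn_system R = eq_time R # eq_pending R # concat (map local_eqs R)"

definition horn_solution :: "rule list \<Rightarrow> nat \<Rightarrow> (unk \<Rightarrow> int \<times> int \<Rightarrow> nat) \<Rightarrow> bool" where
  "horn_solution R n c \<longleftrightarrow> (\<forall>u. finite {p. c u p \<noteq> 0}) \<and>
     (\<forall>p. lhs (eq_time R) c p = of_bool (p = (0, 0))) \<and>
     (\<forall>p. lhs (eq_pending R) c p = of_bool (p = (0, int n))) \<and>
     (\<forall>r\<in>set R. \<forall>e\<in>set (local_eqs r). \<forall>p. lhs e c p = 0)"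

lemma lhs_simps [simp]:
  "lhs [] c p = 0" "lhs ((k, d, u) # e) c p = k * int (c u (p - d)) + lhs e c p"
  "lhs (e @ e') c p = lhs e c p + lhs e' c p"
  by (auto simp: lhs_def)

lemma lhs_concat_map: "lhs (concat (map f xs)) c p = (\<Sum>x\<leftarrow>xs. lhs (f x) c p)"
  by (induction xs) auto

text \<open>The item list encodes the right-hand sides: \<open>1\<close> for the time equation and
  \<open>Y^n\<close> for the pending equation, the rest being homogeneous.\<close>

lemma horn_system_solution_iff:
  "((\<forall>u. finite {p. c u p \<noteq> 0}) \<and>
     (\<forall>j<length (horn_system R). \<forall>p. lhs (horn_system R ! j) c p =
        item_coeff [(0, 1, (0, 0)), (1, 1, (0, int n))] j p)) \<longleftrightarrow> horn_solution R n c"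
proof -
  let ?I = "[(0, 1, (0, 0)), (1, 1, (0, int n))] :: item list"
  have coeff: "item_coeff ?I 0 p = of_bool (p = (0, 0))" "item_coeff ?I (Suc 0) p = of_bool (p = (0, int n))"
    "item_coeff ?I (Suc (Suc j)) p = 0" for p j
    by (auto simp: item_coeff_def)
  have "(\<forall>j<length (horn_system R). \<forall>p. lhs (horn_system R ! j) c p = item_coeff ?I j p) \<longleftrightarrow>
     (\<forall>p. lhs (eq_time R) c p = of_bool (p = (0, 0))) \<and>
     (\<forall>p. lhs (eq_pending R) c p = of_bool (p = (0, int n))) \<and>
     (\<forall>j<length (concat (map local_eqs R)). \<forall>p. lhs (concat (map local_eqs R) ! j) c p = 0)"
    unfolding horn_system_def by (simp only: length_Cons All_less_Suc2 nth_Cons_0 nth_Cons_Suc coeff)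
  also have "(\<forall>j<length (concat (map local_eqs R)). \<forall>p. lhs (concat (map local_eqs R) ! j) c p = 0) \<longleftrightarrow>
     (\<forall>e\<in>set (concat (map local_eqs R)). \<forall>p. lhs e c p = 0)"
    by (metis in_set_conv_nth)
  finally show ?thesis by (auto simp: horn_solution_def)
qed

section \<open>What nonnegativity and finite support force\<close>

lemma finite_support_bounds:
  fixes f :: "int \<Rightarrow> 'b::zero"
  assumes "finite {t. f t \<noteq> 0}"
  obtains lo hi where "\<And>t. t \<le> lo \<Longrightarrow> f t = 0" "\<And>t. hi \<le> t \<Longrightarrow> f t = 0" "lo < 0" "0 < hi"
proof -
  obtain B where B: "\<And>t. t \<in> {t. f t \<noteq> 0} \<Longrightarrow> \<bar>t\<bar> \<le> B"
    using finite_imageI[OF assms, of abs] by (metis Max_ge imageI)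
  show thesis
  proof (rule that[of "- (\<bar>B\<bar> + 1)" "\<bar>B\<bar> + 1"])
    fix t assume "t \<le> - (\<bar>B\<bar> + 1)"
    then show "f t = 0" using B[of t] by fastforce
  next
    fix t assume "\<bar>B\<bar> + 1 \<le> t"
    then show "f t = 0" using B[of t] by fastforce
  qed auto
qed

text \<open>Far to the left \<open>f\<close> vanishes, and from there on it can grow only at 0, by
  at most \<open>b\<close>.\<close>

lemma finite_support_le:
  fixes f :: "int \<Rightarrow> int"
  assumes "finite {t. f t \<noteq> 0}" "\<And>t. f t \<le> f (t - 1) + (if t = 0 then b else 0)" "0 \<le> b"
  shows "f t \<le> (if t < 0 then 0 else b)"
proof -
  obtain lo where lo: "\<And>t. t \<le> lo \<Longrightarrow> f t = 0" "lo < 0"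
    using finite_support_bounds[OF assms(1)] by metis
  show ?thesis
  proof (cases "t \<le> lo")
    case True
    then show ?thesis using lo(1)[OF True] assms(3) by simp
  next
    case False
    then have "lo \<le> t" by simp
    then show ?thesis
    proof (induction t rule: int_ge_induct)
      case base
      then show ?case using lo assms(3) by simp
    next
      case (step t)
      then show ?case using assms(2)[of "t + 1"] assms(3) by (auto split: if_splits)
    qed
  qed
qed

text \<open>\<open>Q\<close> can rise only at 0, to at most one, and must fall again by finiteness.
  So it is the indicator of an interval from 0 up to, but excluding, some \<open>v\<close>, and
  \<open>V\<close> marks the point where it falls.\<close>

lemma token_exists:
  fixes V Q :: "int \<Rightarrow> nat"
  assumes "finite {y. Q y \<noteq> 0}" "\<And>y. V y + Q y = of_bool (y = 0) + Q (y - 1)"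
  shows "\<exists>v::nat. \<forall>y. V y = of_bool (y = int v)"
proof -
  have "int (Q y) \<le> int (Q (y - 1)) + (if y = 0 then 1 else 0)" for y
    using assms(2)[of y] by (cases "y = 0") auto
  then have int_le: "int (Q y) \<le> (if y < 0 then 0 else 1)" for y
    using finite_support_le[of "\<lambda>y. int (Q y)" 1 y] assms(1) by simp
  have le: "Q y \<le> of_bool (y \<ge> 0)" for y
    using int_le[of y] by (cases "y < 0") auto
  obtain hi where hi: "\<And>y. hi \<le> y \<Longrightarrow> Q y = 0" "0 < hi"
    using finite_support_bounds[OF assms(1)] by metis
  define v where "v = (LEAST v. Q (int v) = 0)"
  have "Q (int (nat hi)) = 0" using hi by simp
  then have v: "Q (int v) = 0" unfolding v_def by (rule LeastI)
  have below: "Q y = 1" if "0 \<le> y" "y < int v" for y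
  proof -
    have "nat y < v" using that by simp
    then have "Q (int (nat y)) \<noteq> 0" unfolding v_def by (rule not_less_Least)
    then show ?thesis using le[of y] that by auto
  qed
  have above: "Q y = 0" if "int v \<le> y" for y
    using that
  proof (induction y rule: int_ge_induct)
    case (step y)
    then show ?case using assms(2)[of "y + 1"] by auto
  qed (rule v)
  have neg: "Q y = 0" if "y < 0" for y using le[of y] that by simp
  have "V y = of_bool (y = int v)" for y
  proof -
    consider "y < 0" | "0 \<le> y" "y < int v" | "y = int v" | "y > int v" by linarith
    then show ?thesis
    proof cases
      case 1
      then show ?thesis using assms(2)[of y] neg[of y] neg[of "y - 1"] by simp
    next
      case 2
      then show ?thesis
        using assms(2)[of y] below[of y] below[of "y - 1"] neg[of "y - 1"] by (cases "y = 0") auto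
    next
      case 3
      then show ?thesis
        using assms(2)[of y] v below[of "y - 1"] neg[of "y - 1"] by (cases "y = 0") auto
    next
      case 4
      then show ?thesis using assms(2)[of y] above[of y] above[of "y - 1"] by simp
    qed
  qed
  then show ?thesis by blast
qed

lemma token_absent:
  fixes V Q :: "int \<Rightarrow> nat"
  assumes "finite {y. Q y \<noteq> 0}" "\<And>y. V y + Q y = Q (y - 1)"
  shows "V y = 0"
proof -
  have "int (Q y) \<le> int (Q (y - 1))" for y using assms(2)[of y] by linarith
  then have "int (Q y) \<le> 0" for y
    using finite_support_le[of "\<lambda>y. int (Q y)" 0 y] assms(1) by simp
  then show ?thesis using assms(2)[of y] by simp
qed

text \<open>Summation by parts: a shift of \<open>w\<close> is moved to the test function. The
  window must contain the support of \<open>w\<close> together with its shift.\<close>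

lemma moment_shift:
  fixes w \<phi> :: "int \<Rightarrow> int"
  assumes "\<And>y. w y \<noteq> 0 \<Longrightarrow> \<bar>y\<bar> + \<bar>d\<bar> \<le> N"
  shows "(\<Sum>y=-N..N. \<phi> y * w (y - d)) = (\<Sum>y=-N..N. \<phi> (y + d) * w y)"
proof -
  have "(\<Sum>y=-N..N. \<phi> y * w (y - d)) = (\<Sum>y\<in>{y\<in>{-N..N}. w (y - d) \<noteq> 0}. \<phi> y * w (y - d))"
    by (intro sum.mono_neutral_right) auto
  also have "\<dots> = (\<Sum>y\<in>{y\<in>{-N..N}. w y \<noteq> 0}. \<phi> (y + d) * w y)"
  proof (rule sum.reindex_bij_witness[of _ "\<lambda>y. y + d" "\<lambda>y. y - d"])
    fix y assume "y \<in> {y \<in> {- N..N}. w (y - d) \<noteq> 0}"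
    then show "y - d \<in> {y \<in> {- N..N}. w y \<noteq> 0}" using assms[of "y - d"] by auto
  next
    fix y assume "y \<in> {y \<in> {- N..N}. w y \<noteq> 0}"
    then show "y + d \<in> {y \<in> {- N..N}. w (y - d) \<noteq> 0}" using assms[of "y"] by auto
  qed auto
  also have "\<dots> = (\<Sum>y=-N..N. \<phi> (y + d) * w y)"
    by (intro sum.mono_neutral_left) auto
  finally show ?thesis .
qed

definition node_eq :: "nat \<Rightarrow> nat \<Rightarrow> nat \<Rightarrow> nat \<Rightarrow> (int \<Rightarrow> int) \<Rightarrow> bool" where
  "node_eq a b c d w \<longleftrightarrow> finite {y. w y \<noteq> 0} \<and>
    (\<forall>y. of_bool (y = int c) - of_bool (y = int a) - of_bool (y = int b)
      - of_bool (y - 1 = int d) + of_bool (y = int d) + of_bool (y - 1 = 0)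
      = w (y - 3) - 3 * w (y - 2) + 3 * w (y - 1) - w y)"

text \<open>The third difference kills the moments of order 0, 1 and 2; the first and second moment
  of the left-hand side are \<open>c - a - b\<close> and \<open>c\<^sup>2 - a\<^sup>2 - b\<^sup>2 - 2 * d\<close>.\<close>

lemma node_sound:
  assumes "node_eq a b c d w"
  shows "c = a + b \<and> d = a * b"
proof -
  have fin: "finite {y. w y \<noteq> 0}"
    and eq: "of_bool (y = int c) - of_bool (y = int a) - of_bool (y = int b)
      - of_bool (y - 1 = int d) + of_bool (y = int d) + of_bool (y - 1 = 0)
      = w (y - 3) - 3 * w (y - 2) + 3 * w (y - 1) - w y" for y
    using assms by (simp_all add: node_eq_def)
  obtain B where B: "\<And>y. w y \<noteq> 0 \<Longrightarrow> \<bar>y\<bar> \<le> B"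
    using finite_imageI[OF fin, of abs] by (metis (mono_tags, lifting) Max_ge imageI mem_Collect_eq)
  \<comment> \<open>Large enough for the support of \<open>w\<close> with shifts up to 3 and for all
    points on the left-hand side, the outermost being of the form \<open>d + 1\<close>.\<close>
  define N where "N = \<bar>B\<bar> + int a + int b + int c + int d + 4"
  have shift: "(\<Sum>y=-N..N. \<phi> y * w (y - k)) = (\<Sum>y=-N..N. \<phi> (y + k) * w y)" if "\<bar>k\<bar> \<le> 3" for \<phi> k
  proof (rule moment_shift)
    fix y assume "w y \<noteq> 0"
    then have "\<bar>y\<bar> \<le> B" by (rule B)
    then show "\<bar>y\<bar> + \<bar>k\<bar> \<le> N" using that by (simp add: N_def)
  qed
  \<comment> \<open>The hypothesis on the test function says that its third difference vanishes, as
    for polynomials of degree at most 2.\<close>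
  have rhs: "(\<Sum>y=-N..N. \<phi> y * (w (y - 3) - 3 * w (y - 2) + 3 * w (y - 1) - w y)) = 0"
    if "\<And>y. \<phi> (y + 3) - 3 * \<phi> (y + 2) + 3 * \<phi> (y + 1) - \<phi> y = 0" for \<phi> :: "int \<Rightarrow> int"
  proof -
    have "(\<Sum>y=-N..N. \<phi> y * (w (y - 3) - 3 * w (y - 2) + 3 * w (y - 1) - w y)) =
       (\<Sum>y=-N..N. \<phi> y * w (y - 3)) - 3 * (\<Sum>y=-N..N. \<phi> y * w (y - 2))
       + 3 * (\<Sum>y=-N..N. \<phi> y * w (y - 1)) - (\<Sum>y=-N..N. \<phi> y * w y)"
      by (simp add: sum_subtractf sum.distrib sum_distrib_left algebra_simps)
    also have "\<dots> = (\<Sum>y=-N..N. (\<phi> (y + 3) - 3 * \<phi> (y + 2) + 3 * \<phi> (y + 1) - \<phi> y) * w y)"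
      using shift[of 3 \<phi>] shift[of 2 \<phi>] shift[of 1 \<phi>]
      by (simp add: sum_subtractf sum.distrib sum_distrib_left algebra_simps)
    also have "\<dots> = 0" using that by simp
    finally show ?thesis .
  qed
  have delta: "(\<Sum>y=-N..N. \<phi> y * of_bool (y = z)) = \<phi> z" if "\<bar>z\<bar> \<le> N" for z and \<phi> :: "int \<Rightarrow> int"
  proof -
    have "(\<Sum>y=-N..N. \<phi> y * of_bool (y = z)) = (\<Sum>y=-N..N. if y = z then \<phi> y else 0)"
      by (intro sum.cong) auto
    moreover have "z \<in> {-N..N}" using that by auto
    ultimately show ?thesis by (simp add: sum.delta)
  qed
  have lhs: "(\<Sum>y=-N..N. \<phi> y * (of_bool (y = int c) - of_bool (y = int a) - of_bool (y = int b)
      - of_bool (y - 1 = int d) + of_bool (y = int d) + of_bool (y - 1 = 0))) =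
      \<phi> (int c) - \<phi> (int a) - \<phi> (int b) - \<phi> (int d + 1) + \<phi> (int d) + \<phi> 1" for \<phi> :: "int \<Rightarrow> int"
  proof -
    have [simp]: "y - 1 = z \<longleftrightarrow> y = z + 1" for y z :: int by auto
    show ?thesis
      using delta[of "int a" \<phi>] delta[of "int b" \<phi>] delta[of "int c" \<phi>] delta[of "int d" \<phi>]
        delta[of "int d + 1" \<phi>] delta[of 1 \<phi>]
      by (simp add: ring_distribs sum_subtractf sum.distrib N_def)
  qed
  have *: "\<phi> (int c) - \<phi> (int a) - \<phi> (int b) - \<phi> (int d + 1) + \<phi> (int d) + \<phi> 1 = 0"
    if "\<And>y. \<phi> (y + 3) - 3 * \<phi> (y + 2) + 3 * \<phi> (y + 1) - \<phi> y = 0" for \<phi> :: "int \<Rightarrow> int"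
    using lhs[of \<phi>] rhs[OF that] unfolding eq by simp
  have 1: "int c = int a + int b"
    using *[of "\<lambda>y. y"] by simp
  have "int c * int c - int a * int a - int b * int b - (int d + 1) * (int d + 1) + int d * int d + 1 = 0"
    using *[of "\<lambda>y. y * y"] by (simp add: algebra_simps)
  then have "int d = int a * int b" unfolding 1 by (simp add: algebra_simps)
  then show ?thesis using 1 by (metis of_nat_add of_nat_eq_iff of_nat_mult)
qed

section \<open>Every solution of the system contains a derivation\<close>

locale horn_sol =
  fixes R :: "rule list" and n :: nat and c
  assumes distinct: "distinct R" and sol: "horn_solution R n c"
begin

lemma finite_support: "finite {p. c u p \<noteq> 0}"
  using sol by (simp add: horn_solution_def)

lemma finite_column: "finite {y. c u (t, y) \<noteq> 0}"
proof -
  have "{y. c u (t, y) \<noteq> 0} \<subseteq> snd ` {p. c u p \<noteq> 0}" by force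
  then show ?thesis using finite_support finite_subset by blast
qed

lemma finite_row: "finite {t. c u (t, y) \<noteq> 0}"
proof -
  have "{t. c u (t, y) \<noteq> 0} \<subseteq> fst ` {p. c u p \<noteq> 0}" by force
  then show ?thesis using finite_support finite_subset by blast
qed

lemma time_eq:
  "(\<Sum>r\<in>set R. int (c (US r) (t, y))) + int (c UE (t, y)) =
   (\<Sum>r\<in>set R. int (c (US r) (t - 1, y))) + of_bool (t = 0 \<and> y = 0)"
proof -
  have "lhs (eq_time R) c (t, y) = of_bool ((t, y) = (0, 0))"
    using sol by (simp add: horn_solution_def)
  then show ?thesis
    by (simp add: eq_time_def lhs_concat_map sum_list_distinct_conv_sum_set[OF distinct] sum_subtractf)
qed

text \<open>As \<open>UE\<close> is nonnegative, the time equation lets the total number of starts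
  grow only at the origin. Hence a column hosts at most one rule application, and it starts at
  height 0.\<close>

lemma starts_le: "(\<Sum>r\<in>set R. c (US r) (t, y)) \<le> of_bool (y = 0)"
proof -
  have "{t. (\<Sum>r\<in>set R. int (c (US r) (t, y))) \<noteq> 0} \<subseteq> (\<Union>r\<in>set R. {t. c (US r) (t, y) \<noteq> 0})"
    by (auto dest: sum.not_neutral_contains_not_neutral)
  then have "finite {t. (\<Sum>r\<in>set R. int (c (US r) (t, y))) \<noteq> 0}"
    by (rule finite_subset) (rule finite_UN_I, simp, rule finite_row)
  moreover have "(\<Sum>r\<in>set R. int (c (US r) (t, y))) \<le>
      (\<Sum>r\<in>set R. int (c (US r) (t - 1, y))) + (if t = 0 then of_bool (y = 0) else 0)" for t
    using time_eq[of t y] by (auto split: if_splits)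
  ultimately have "(\<Sum>r\<in>set R. int (c (US r) (t, y))) \<le> (if t < 0 then 0 else of_bool (y = 0))"
    by (rule finite_support_le) simp
  then have "int (\<Sum>r\<in>set R. c (US r) (t, y)) \<le> int (of_bool (y = 0))"
    by (auto split: if_splits)
  then show ?thesis by (simp only: of_nat_le_iff)
qed

lemma start_le: "r \<in> set R \<Longrightarrow> c (US r) (t, y) \<le> of_bool (y = 0)"
  using starts_le[of t y] member_le_sum[of r "set R" "\<lambda>r. c (US r) (t, y)"] by fastforce

lemma start_unique:
  assumes "r \<in> set R" "r' \<in> set R" "c (US r) (t, 0) \<noteq> 0" "c (US r') (t, 0) \<noteq> 0"
  shows "r = r'"
proof (rule ccontr)
  assume "r \<noteq> r'"
  then have "c (US r) (t, 0) + c (US r') (t, 0) = (\<Sum>r\<in>{r, r'}. c (US r) (t, 0))" by simp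
  also have "\<dots> \<le> (\<Sum>r\<in>set R. c (US r) (t, 0))"
    using assms by (intro sum_mono2) auto
  also have "\<dots> \<le> 1" using starts_le[of t 0] by simp
  finally show False using assms by simp
qed

lemma local_eq: "r \<in> set R \<Longrightarrow> e \<in> set (local_eqs r) \<Longrightarrow> lhs e c p = 0"
  using sol unfolding horn_solution_def by blast

lemma token_eq:
  assumes "r \<in> set R" "x \<in> set (concat (map subterms (rule_terms r)))"
  shows "c (UV r x) (t, y) + c (UQ r x) (t, y) = c (US r) (t, y) + c (UQ r x) (t, y - 1)"
proof -
  have "eq_token r x \<in> set (local_eqs r)" using assms(2) by (simp add: local_eqs_def)
  from local_eq[OF assms(1) this, of "(t, y)"] show ?thesis by (simp add: eq_token_def)
qed

text \<open>Without a start the quotient \<open>UQ\<close> can never rise, so there is no token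
  either: an idle column contributes nothing to the balance.\<close>

lemma inactive:
  assumes "r \<in> set R" "x \<in> set (concat (map subterms (rule_terms r)))" "c (US r) (t, 0) = 0"
  shows "c (UV r x) (t, y) = 0"
proof (rule token_absent)
  show "finite {y. c (UQ r x) (t, y) \<noteq> 0}" by (rule finite_column)
  show "c (UV r x) (t, y) + c (UQ r x) (t, y) = c (UQ r x) (t, y - 1)" for y
    using token_eq[OF assms(1,2), of t y] start_le[OF assms(1), of t y] assms(3)
    by (cases "y = 0") auto
qed

lemma active:
  assumes r: "r \<in> set R" "c (US r) (t, 0) \<noteq> 0"
  shows "\<exists>\<sigma>. \<forall>x\<in>set (rule_terms r). \<forall>y. c (UV r x) (t, y) = of_bool (y = int (tm_val \<sigma> x))"
proof -
  let ?T = "set (concat (map subterms (rule_terms r)))"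
  have start: "c (US r) (t, y) = of_bool (y = 0)" for y
    using start_le[OF r(1), of t y] r(2) by (cases "y = 0") auto
  have "\<exists>v::nat. \<forall>y. c (UV r x) (t, y) = of_bool (y = int v)" if "x \<in> ?T" for x
  proof (rule token_exists)
    show "finite {y. c (UQ r x) (t, y) \<noteq> 0}" by (rule finite_column)
  qed (use token_eq[OF r(1) that, of t] in \<open>simp add: start\<close>)
  then obtain v where v: "\<And>x y. x \<in> ?T \<Longrightarrow> c (UV r x) (t, y) = of_bool (y = int (v x))" by metis
  \<comment> \<open>Tokens are indexed by terms, not by occurrences, so a variable has the same
    value throughout the rule.\<close>
  let ?\<sigma> = "\<lambda>i. v (Var i)"
  have num: "v (Num k) = k" if "k \<in> set (concat (map nums (rule_terms r)))" "Num k \<in> ?T" for k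
  proof -
    have "eq_num r k \<in> set (local_eqs r)" using that by (simp add: local_eqs_def)
    from local_eq[OF r(1) this, of "(t, int k)"] show ?thesis
      using that(2) by (simp add: eq_num_def v start of_bool_def split: if_splits)
  qed
  have node: "v (Add a b) = v a + v b \<and> v (Mul a b) = v a * v b"
    if "(a, b) \<in> set (concat (map nodes (rule_terms r)))" "{a, b, Add a b, Mul a b} \<subseteq> ?T" for a b
  proof (rule node_sound)
    let ?w = "\<lambda>y. int (c (UWp r a b) (t, y)) - int (c (UWn r a b) (t, y))"
    have "{y. ?w y \<noteq> 0} \<subseteq> {y. c (UWp r a b) (t, y) \<noteq> 0} \<union> {y. c (UWn r a b) (t, y) \<noteq> 0}" by auto
    then have "finite {y. ?w y \<noteq> 0}" by (rule finite_subset) (intro finite_UnI finite_column)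
    moreover have "of_bool (y = int (v (Add a b))) - of_bool (y = int (v a)) - of_bool (y = int (v b))
      - of_bool (y - 1 = int (v (Mul a b))) + of_bool (y = int (v (Mul a b))) + of_bool (y - 1 = 0)
      = ?w (y - 3) - 3 * ?w (y - 2) + 3 * ?w (y - 1) - ?w y" for y
    proof -
      have T: "a \<in> ?T" "b \<in> ?T" "Add a b \<in> ?T" "Mul a b \<in> ?T" using that(2) by auto
      have "eq_node r a b \<in> set (local_eqs r)"
        using that(1) unfolding local_eqs_def set_append by (intro UnI2) force
      from local_eq[OF r(1) this, of "(t, y)"]
      show ?thesis
        by (simp add: eq_node_def v[OF T(1)] v[OF T(2)] v[OF T(3)] v[OF T(4)] start algebra_simps)
    qed
    ultimately show "node_eq (v a) (v b) (v (Add a b)) (v (Mul a b)) ?w"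
      unfolding node_eq_def by blast
  qed
  have self: "z \<in> set (subterms z)" for z by (cases z) auto
  have val: "v x = tm_val ?\<sigma> x" if "set (subterms x) \<subseteq> ?T"
    "set (nodes x) \<subseteq> set (concat (map nodes (rule_terms r)))"
    "set (nums x) \<subseteq> set (concat (map nums (rule_terms r)))" for x
    using that
  proof (induction x)
    case (Num k)
    then show ?case using num by simp
  next
    case (Add a b)
    have "a \<in> ?T" "b \<in> ?T" using Add.prems(1) self[of a] self[of b] by (simp_all only: subterms.simps set_simps set_append) blast+
    then show ?case using Add node[of a b] by simp
  next
    case (Mul a b)
    have "a \<in> ?T" "b \<in> ?T" using Mul.prems(1) self[of a] self[of b] by (simp_all only: subterms.simps set_simps set_append) blast+
    then show ?case using Mul node[of a b] by simp
  qed simp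
  have "c (UV r x) (t, y) = of_bool (y = int (tm_val ?\<sigma> x))" if x: "x \<in> set (rule_terms r)" for x y
  proof -
    have "x \<in> ?T" using x self by auto
    moreover have "v x = tm_val ?\<sigma> x" by (rule val) (use x in auto)
    ultimately show ?thesis using v by simp
  qed
  then show ?thesis by blast
qed

text \<open>The obligations open just before column \<open>t\<close>; the goal itself joins them at
  column 0.\<close>

definition pending :: "int \<Rightarrow> int \<Rightarrow> nat" where
  "pending t y = c UT (t - 1, y) + of_bool (t = 0 \<and> y = int n)"

lemma pending_eq:
  "int (c UT (t, y)) + (\<Sum>r\<in>set R. int (c (UV r (fst r)) (t, y))) =
   int (pending t y) + (\<Sum>r\<in>set R. \<Sum>p\<leftarrow>snd r. int (c (UV r p) (t, y)))"
proof -
  have *: "lhs (map (\<lambda>p. (-1, (0, 0), UV r p)) ps) c p = - (\<Sum>q\<leftarrow>ps. int (c (UV r q) p))" for r ps p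
    by (induction ps) (auto simp: zero_prod_def[symmetric])
  have "lhs (eq_pending R) c (t, y) = of_bool ((t, y) = (0, int n))"
    using sol by (simp add: horn_solution_def)
  then show ?thesis
    by (simp add: eq_pending_def lhs_concat_map sum_list_distinct_conv_sum_set[OF distinct] *
        sum_subtractf pending_def)
qed

text \<open>One step from right to left: an obligation open before a column is either still open
  after it, or it is the conclusion of the rule applied there, and then every premise of that rule
  is open after the column.\<close>

lemma pending_step:
  assumes later: "\<And>y. c UT (t, y) > 0 \<Longrightarrow> 0 \<le> y \<and> derives R (nat y)"
    and y: "pending t y > 0"
  shows "0 \<le> y \<and> derives R (nat y)"
proof (cases "\<exists>r\<in>set R. c (US r) (t, 0) \<noteq> 0")
  case False
  have z: "c (UV r x) (t, y) = 0" if "r \<in> set R" "x \<in> set (rule_terms r)" for r x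
  proof (rule inactive[OF that(1)])
    have "x \<in> set (subterms x)" by (cases x) auto
    then show "x \<in> set (concat (map subterms (rule_terms r)))" using that by auto
  qed (use False that in auto)
  have "(\<Sum>r\<in>set R. int (c (UV r (fst r)) (t, y))) = 0"
    by (intro sum.neutral) (auto simp: z rule_terms_def)
  moreover have "(\<Sum>r\<in>set R. \<Sum>p\<leftarrow>snd r. int (c (UV r p) (t, y))) = 0"
    by (intro sum.neutral ballI sum_list_0 arg_cong[where f = sum_list])
      (auto simp: z rule_terms_def cong: map_cong)
  ultimately have "c UT (t, y) = pending t y" using pending_eq[of t y] by simp
  then show ?thesis using later y by simp
next
  case True
  then obtain r where r: "r \<in> set R" "c (US r) (t, 0) \<noteq> 0" by blast
  obtain \<sigma> where \<sigma>: "\<And>x y. x \<in> set (rule_terms r) \<Longrightarrow> c (UV r x) (t, y) = of_bool (y = int (tm_val \<sigma> x))"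
    using active[OF r] by blast
  have z: "c (UV s x) (t, y) = 0" if "s \<in> set R - {r}" "x \<in> set (rule_terms s)" for s x y
  proof (rule inactive)
    have "x \<in> set (subterms x)" by (cases x) auto
    then show "x \<in> set (concat (map subterms (rule_terms s)))" using that by auto
    show "c (US s) (t, 0) = 0" using start_unique[OF r(1) _ r(2), of s] that by auto
  qed (use that in auto)
  have C: "(\<Sum>s\<in>set R. int (c (UV s (fst s)) (t, y))) = of_bool (y = int (tm_val \<sigma> (fst r)))" for y
    using r(1) by (subst sum.remove[of _ r]) (auto simp: z \<sigma> rule_terms_def intro!: sum.neutral)
  have map0: "(\<Sum>p\<leftarrow>ps. f p) = (0::int)" if "\<And>p. p \<in> set ps \<Longrightarrow> f p = 0" for ps :: "tm list" and f
    using that by (induction ps) auto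
  have "(\<Sum>s\<in>set R - {r}. \<Sum>p\<leftarrow>snd s. int (c (UV s p) (t, y))) = 0" for y
    by (intro sum.neutral ballI map0) (simp add: z rule_terms_def)
  then have "(\<Sum>s\<in>set R. \<Sum>p\<leftarrow>snd s. int (c (UV s p) (t, y))) = (\<Sum>p\<leftarrow>snd r. int (c (UV r p) (t, y)))" for y
    using r(1) by (subst sum.remove[of _ r]) auto
  moreover have "(\<Sum>p\<leftarrow>snd r. int (c (UV r p) (t, y))) = (\<Sum>p\<leftarrow>snd r. of_bool (y = int (tm_val \<sigma> p)))" for y
    by (intro arg_cong[where f = sum_list] map_cong) (auto simp: \<sigma> rule_terms_def)
  ultimately have eq: "int (c UT (t, y)) + of_bool (y = int (tm_val \<sigma> (fst r))) =
      int (pending t y) + (\<Sum>p\<leftarrow>snd r. of_bool (y = int (tm_val \<sigma> p)))" for y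
    using pending_eq[of t y] C by simp
  have nonneg: "0 \<le> (\<Sum>p\<leftarrow>ps. of_bool (y = int (tm_val \<sigma> p)) :: int)" for ps y
    by (intro sum_list_nonneg) auto
  show ?thesis
  proof (cases "c UT (t, y) > 0")
    case True
    then show ?thesis using later by blast
  next
    case False
    have yc: "y = int (tm_val \<sigma> (fst r))"
      using eq[of y] False y nonneg[of y "snd r"]
      by (cases "y = int (tm_val \<sigma> (fst r))") auto
    have "derives R (tm_val \<sigma> p)" if p: "p \<in> set (snd r)" for p
    proof -
      have mem: "1 \<le> (\<Sum>p\<leftarrow>ps. of_bool (y = int (tm_val \<sigma> p)) :: int)"
        if "p \<in> set ps" "y = int (tm_val \<sigma> p)" for ps y
        using that
      proof (induction ps)
        case (Cons q qs)
        then show ?case using nonneg[of y qs] by auto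
      qed simp
      \<comment> \<open>At \<open>y\<close> the rule removes one obligation, at least one was open
        and none remains, so no premise can have added one there. This excludes an application that
        uses its own conclusion as a premise.\<close>
      have "int (tm_val \<sigma> p) \<noteq> y"
        using eq[of y] False y mem[OF p, of y] yc by auto
      then have "c UT (t, int (tm_val \<sigma> p)) > 0"
        using eq[of "int (tm_val \<sigma> p)"] mem[OF p refl] yc by (auto split: if_splits)
      then show ?thesis using later[of "int (tm_val \<sigma> p)"] by simp
    qed
    then have "derives R (tm_val \<sigma> (fst r))"
      using r(1) by (intro derives_rule[of "fst r" "snd r"]) auto
    then show ?thesis using yc by simp
  qed
qed

lemma derives_goal: "derives R n"
proof -
  obtain hi where hi: "\<And>t y. hi \<le> t \<Longrightarrow> c UT (t, y) = 0" "0 < hi"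
  proof -
    have "finite (fst ` {p. c UT p \<noteq> 0})" using finite_support by simp
    moreover have "fst ` {p. c UT p \<noteq> 0} = {t. of_bool (\<exists>y. c UT (t, y) \<noteq> 0) \<noteq> (0::nat)}" by force
    ultimately obtain h where h: "\<And>t. h \<le> t \<Longrightarrow> of_bool (\<exists>y. c UT (t, y) \<noteq> 0) = (0::nat)" "0 < h"
      using finite_support_bounds[of "\<lambda>t. of_bool (\<exists>y. c UT (t, y) \<noteq> 0) :: nat"] by metis
    show thesis by (rule that[of h]) (use h in auto)
  qed
  \<comment> \<open>Induction to the left from \<open>hi + 1\<close>, where nothing is open:
    \<open>UT\<close> vanishes in column \<open>hi\<close>, and the goal joins only at 0.\<close>
  have "\<forall>y. pending t y > 0 \<longrightarrow> 0 \<le> y \<and> derives R (nat y)" if "t \<le> hi + 1" for t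
    using that
  proof (induction t rule: int_le_induct)
    case base
    then show ?case using hi by (simp add: pending_def)
  next
    case (step t)
    have "c UT (t - 1, y) > 0 \<Longrightarrow> 0 \<le> y \<and> derives R (nat y)" for y
      using step(2) by (simp add: pending_def)
    then show ?case using pending_step by blast
  qed
  from this[of 0] show ?thesis using hi(2) by (auto simp: pending_def dest: spec[of _ "int n"])
qed

end

section \<open>Every derivation gives a solution of the system\<close>

fun run :: "rule list \<Rightarrow> nat multiset \<Rightarrow> (rule \<times> (nat \<Rightarrow> nat)) list \<Rightarrow> bool" where
  "run R M [] \<longleftrightarrow> M = {#}"
| "run R M ((r, \<sigma>) # \<rho>) \<longleftrightarrow> r \<in> set R \<and> tm_val \<sigma> (fst r) \<in># M \<and>
     run R (M - {#tm_val \<sigma> (fst r)#} + mset (map (tm_val \<sigma>) (snd r))) \<rho>"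

text \<open>Schedules a derivation tree as a sequence, one application for each future column. The
  arbitrary rest \<open>M\<close> allows the subtrees of the premises to be worked off one after
  another.\<close>

lemma derives_run: "derives R x \<Longrightarrow> \<exists>\<rho>. run R M \<rho> \<Longrightarrow> \<exists>\<rho>. run R (add_mset x M) \<rho>"
proof (induction arbitrary: M rule: derives.induct)
  case (derives_rule h ps \<sigma>)
  have "\<exists>\<rho>. run R (M + mset (map (tm_val \<sigma>) qs)) \<rho>" if "set qs \<subseteq> set ps" for qs
    using that
  proof (induction qs)
    case Nil
    then show ?case using derives_rule(4) by simp
  next
    case (Cons q qs)
    then show ?case using derives_rule(3)[of q "M + mset (map (tm_val \<sigma>) qs)"] by auto
  qed
  then obtain \<rho> where "run R (M + mset (map (tm_val \<sigma>) ps)) \<rho>" by blast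
  then have "run R (add_mset (tm_val \<sigma> h) M) (((h, ps), \<sigma>) # \<rho>)" using derives_rule(1) by simp
  then show ?case by blast
qed

text \<open>The successive multisets of obligations, with the transition written free of subtraction
  so that counting multiplicities gives the pending equation.\<close>

lemma run_states:
  "run R M \<rho> \<Longrightarrow> \<exists>Ms. Ms 0 = M \<and> Ms (length \<rho>) = {#} \<and>
    (\<forall>t<length \<rho>. fst (\<rho> ! t) \<in> set R \<and>
      add_mset (tm_val (snd (\<rho> ! t)) (fst (fst (\<rho> ! t)))) (Ms (Suc t)) =
      Ms t + mset (map (tm_val (snd (\<rho> ! t))) (snd (fst (\<rho> ! t)))))"
proof (induction \<rho> arbitrary: M)
  case (Cons x \<rho>)
  obtain r \<sigma> where x: "x = (r, \<sigma>)" by (cases x)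
  let ?M = "M - {#tm_val \<sigma> (fst r)#} + mset (map (tm_val \<sigma>) (snd r))"
  have r: "r \<in> set R" "tm_val \<sigma> (fst r) \<in># M" "run R ?M \<rho>" using Cons(2) x by auto
  from Cons(1)[OF r(3)] obtain Ms where Ms: "Ms 0 = ?M" "Ms (length \<rho>) = {#}"
    "\<And>t. t < length \<rho> \<Longrightarrow> fst (\<rho> ! t) \<in> set R \<and>
      add_mset (tm_val (snd (\<rho> ! t)) (fst (fst (\<rho> ! t)))) (Ms (Suc t)) =
      Ms t + mset (map (tm_val (snd (\<rho> ! t))) (snd (fst (\<rho> ! t))))" by blast
  show ?case
  proof (intro exI[of _ "case_nat M Ms"] conjI allI impI)
    fix t assume t: "t < length (x # \<rho>)"
    show "fst ((x # \<rho>) ! t) \<in> set R"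
      using t r(1) Ms(3) by (cases t) (auto simp: x)
    show "add_mset (tm_val (snd ((x # \<rho>) ! t)) (fst (fst ((x # \<rho>) ! t)))) (case_nat M Ms (Suc t)) =
      case_nat M Ms t + mset (map (tm_val (snd ((x # \<rho>) ! t))) (snd (fst ((x # \<rho>) ! t))))"
      using t r(2) Ms(1,3) by (cases t) (auto simp: x)
  qed (use Ms in auto)
qed auto

definition int_coeff :: "int poly \<Rightarrow> int \<Rightarrow> int" where
  "int_coeff p y = (if y \<ge> 0 then coeff p (nat y) else 0)"

lemma int_coeff_simps:
  "int_coeff (p + q) y = int_coeff p y + int_coeff q y"
  "int_coeff (p - q) y = int_coeff p y - int_coeff q y"
  "int_coeff (monom 1 k) y = of_bool (y = int k)"
  "int_coeff ([:-1, 1:] * p) y = int_coeff p (y - 1) - int_coeff p y"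
proof -
  have "nat y = Suc (nat (y - 1))" if "y > 0" using that by simp
  then show "int_coeff ([:-1, 1:] * p) y = int_coeff p (y - 1) - int_coeff p y"
    by (cases "y > 0"; cases "y = 0") (auto simp: int_coeff_def coeff_pCons)
qed (auto simp: int_coeff_def)

lemma finite_int_coeff: "finite {y. int_coeff p y \<noteq> 0}"
proof (rule finite_subset)
  show "{y. int_coeff p y \<noteq> 0} \<subseteq> int ` {..degree p}"
  proof
    fix y assume "y \<in> {y. int_coeff p y \<noteq> 0}"
    then have "y = int (nat y)" "nat y \<le> degree p" by (auto simp: int_coeff_def le_degree split: if_splits)
    then show "y \<in> int ` {..degree p}" by blast
  qed
qed simp

text \<open>Write \<open>Y^k - 1 = (Y - 1) * q k\<close> with the geometric sum \<open>q k\<close>,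
  whose value at 1 is \<open>k\<close>. Then \<open>(Y^a - 1)(Y^b - 1) - (Y - 1)(Y^(ab) - 1)\<close>
  is \<open>(Y - 1)^2 * (q a * q b - q (a * b))\<close>, and the last factor vanishes at 1, which
  yields the third factor \<open>Y - 1\<close>.\<close>

lemma node_complete:
  "\<exists>w. node_eq a b (a + b) (a * b) w"
proof -
  let ?x = "[:-1, 1:] :: int poly"
  define q where "q k = (\<Sum>i<k. monom (1::int) i)" for k
  have q: "monom 1 k - 1 = ?x * q k" for k
  proof (induction k)
    case (Suc k)
    have "?x * monom 1 k = monom 1 (Suc k) - monom 1 k"
      by (simp add: monom_Suc algebra_simps)
    then have "monom 1 (Suc k) - 1 = ?x * monom 1 k + (monom 1 k - 1)" by simp
    also have "\<dots> = ?x * (q k + monom 1 k)" by (simp only: Suc distrib_left add.commute)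
    also have "q k + monom 1 k = q (Suc k)" by (simp add: q_def)
    finally show ?case .
  qed (simp add: q_def monom_eq_1)
  have "poly (q k) 1 = int k" for k
    by (simp add: q_def poly_sum poly_monom)
  then have "poly (q a * q b - q (a * b)) 1 = 0" by simp
  then obtain W where W: "q a * q b - q (a * b) = ?x * W"
    using poly_eq_0_iff_dvd[of "q a * q b - q (a * b)" 1] by (auto simp: dvd_def)
  have "monom 1 (a + b) - monom 1 a - monom 1 b + 1 = (monom 1 a - 1) * (monom 1 b - 1 :: int poly)"
    by (simp add: algebra_simps mult_monom)
  also have "\<dots> = ?x * (?x * (q a * q b))" unfolding q by (simp only: ac_simps)
  also have "q a * q b = q (a * b) + ?x * W" using W by (simp add: algebra_simps)
  also have "?x * (?x * (q (a * b) + ?x * W)) = ?x * (?x * q (a * b)) + ?x * (?x * (?x * W))"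
    by (simp only: ring_distribs)
  also have "?x * q (a * b) = monom 1 (a * b) - 1" by (rule q[symmetric])
  also have "?x * (monom 1 (a * b) - 1) = ?x * monom 1 (a * b) - monom 1 1 + 1"
    by (simp add: right_diff_distrib monom_altdef one_pCons)
  finally have eq: "monom 1 (a + b) - monom 1 a - monom 1 b - ?x * monom 1 (a * b) + monom 1 1
     = ?x * (?x * (?x * W))"
    by (simp add: algebra_simps)
  show ?thesis
    unfolding node_eq_def
  proof (intro exI[of _ "int_coeff W"] conjI allI)
    fix y
    have "int_coeff (monom 1 (a + b) - monom 1 a - monom 1 b - ?x * monom 1 (a * b) + monom 1 1) y
       = int_coeff (?x * (?x * (?x * W))) y" by (simp only: eq)
    then show "of_bool (y = int (a + b)) - of_bool (y = int a)
      - of_bool (y = int b) - of_bool (y - 1 = int (a * b)) + of_bool (y = int (a * b)) + of_bool (y - 1 = 0)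
      = int_coeff W (y - 3) - 3 * int_coeff W (y - 2) + 3 * int_coeff W (y - 1) - int_coeff W y"
      by (simp only: int_coeff_simps) (simp add: algebra_simps)
  qed (rule finite_int_coeff)
qed

lemma derives_solution:
  assumes "distinct R" "derives R n"
  shows "\<exists>c. horn_solution R n c"
proof -
  have "\<exists>\<rho>. run R {#n#} \<rho>"
    using derives_run[OF assms(2), of "{#}"] run.simps(1)[of R "{#}"] by blast
  then obtain \<rho> where "run R {#n#} \<rho>" ..
  from run_states[OF this] obtain Ms where "Ms 0 = {#n#} \<and> Ms (length \<rho>) = {#} \<and>
    (\<forall>t<length \<rho>. fst (\<rho> ! t) \<in> set R \<and>
      add_mset (tm_val (snd (\<rho> ! t)) (fst (fst (\<rho> ! t)))) (Ms (Suc t)) =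
      Ms t + mset (map (tm_val (snd (\<rho> ! t))) (snd (fst (\<rho> ! t)))))" ..
  then have Ms: "Ms 0 = {#n#}" "Ms (length \<rho>) = {#}"
    "\<And>t. t < length \<rho> \<Longrightarrow> fst (\<rho> ! t) \<in> set R"
    "\<And>t. t < length \<rho> \<Longrightarrow> add_mset (tm_val (snd (\<rho> ! t)) (fst (fst (\<rho> ! t)))) (Ms (Suc t)) =
      Ms t + mset (map (tm_val (snd (\<rho> ! t))) (snd (fst (\<rho> ! t))))"
    by simp_all
  obtain w where "\<And>a b. node_eq a b (a + b) (a * b) (w a b)"
    using node_complete by metis
  then have w: "\<And>a b. finite {y. w a b y \<noteq> (0::int)}"
    "\<And>a b y. of_bool (y = int (a + b)) - of_bool (y = int a)
      - of_bool (y = int b) - of_bool (y - 1 = int (a * b)) + of_bool (y = int (a * b)) + of_bool (y - 1 = 0)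
      = w a b (y - 3) - 3 * w a b (y - 2) + 3 * w a b (y - 1) - w a b y"
    unfolding node_eq_def by blast+
  define N where "N = int (length \<rho>)"
  define \<sigma> where "\<sigma> t = snd (\<rho> ! nat t)" for t
  define act where "act r t \<longleftrightarrow> 0 \<le> t \<and> t < N \<and> fst (\<rho> ! nat t) = r" for r t
  \<comment> \<open>Column \<open>t\<close> carries the application number \<open>t\<close> of the
    run. \<open>UT\<close> counts what is open after it, hence the index \<open>Suc (nat t)\<close>
    of the state.\<close>
  define c where "c u = (\<lambda>(t, y). case u of
      US r \<Rightarrow> of_bool (act r t \<and> y = 0)
    | UV r x \<Rightarrow> of_bool (act r t \<and> y = int (tm_val (\<sigma> t) x))
    | UQ r x \<Rightarrow> of_bool (act r t \<and> 0 \<le> y \<and> y < int (tm_val (\<sigma> t) x))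
    | UWp r a b \<Rightarrow> if act r t then nat (w (tm_val (\<sigma> t) a) (tm_val (\<sigma> t) b) y) else 0
    | UWn r a b \<Rightarrow> if act r t then nat (- w (tm_val (\<sigma> t) a) (tm_val (\<sigma> t) b) y) else 0
    | UE \<Rightarrow> of_bool (t = N \<and> y = 0)
    | UT \<Rightarrow> if 0 \<le> t \<and> t < N \<and> 0 \<le> y then count (Ms (Suc (nat t))) (nat y) else 0)" for u :: unk and t y :: int
  have "finite {p. c u p \<noteq> 0}" for u
  proof (rule finite_subset)
    have "t \<in> {0..N}" if "c u (t, y) \<noteq> 0" for t y
      using that by (cases u) (auto simp: c_def act_def N_def split: if_splits)
    then show "{p. c u p \<noteq> 0} \<subseteq> Sigma {0..N} (\<lambda>t. {y. c u (t, y) \<noteq> 0})" by auto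
    have "finite {y. c u (t, y) \<noteq> 0}" for t
    proof (cases u)
      case (UWp r a b)
      show ?thesis
        by (rule finite_subset[OF _ w(1)[of "tm_val (\<sigma> t) a" "tm_val (\<sigma> t) b"]]) (auto simp: UWp c_def)
    next
      case (UWn r a b)
      show ?thesis
        by (rule finite_subset[OF _ w(1)[of "tm_val (\<sigma> t) a" "tm_val (\<sigma> t) b"]]) (auto simp: UWn c_def)
    next
      case (US r)
      show ?thesis by (rule finite_subset[of _ "{0}"]) (auto simp: US c_def)
    next
      case (UV r x)
      show ?thesis by (rule finite_subset[of _ "{int (tm_val (\<sigma> t) x)}"]) (auto simp: UV c_def)
    next
      case (UQ r x)
      show ?thesis by (rule finite_subset[of _ "{0..int (tm_val (\<sigma> t) x)}"]) (auto simp: UQ c_def)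
    next
      case UE
      show ?thesis by (rule finite_subset[of _ "{0}"]) (auto simp: UE c_def)
    next
      case UT
      show ?thesis
      proof (rule finite_subset)
        show "{y. c u (t, y) \<noteq> 0} \<subseteq> int ` set_mset (Ms (Suc (nat t)))"
        proof
          fix y assume "y \<in> {y. c u (t, y) \<noteq> 0}"
          then have "nat y \<in># Ms (Suc (nat t))" "y = int (nat y)"
            by (auto simp: UT c_def split: if_splits)
          then show "y \<in> int ` set_mset (Ms (Suc (nat t)))" by blast
        qed
      qed simp
    qed
    then show "finite (Sigma {0..N} (\<lambda>t. {y. c u (t, y) \<noteq> 0}))" by blast
  qed
  moreover have "lhs (eq_time R) c p = of_bool (p = (0, 0))" for p
  proof -
    obtain t y where p: "p = (t, y)" by force
    have sum: "(\<Sum>r\<in>set R. int (c (US r) (t, y))) = of_bool (0 \<le> t \<and> t < N \<and> y = 0)" for t y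
    proof (cases "0 \<le> t \<and> t < N")
      case True
      then have "fst (\<rho> ! nat t) \<in> set R" using Ms(3)[of "nat t"] by (simp add: N_def nat_less_iff)
      moreover have "int (c (US r) (t, y)) = (if fst (\<rho> ! nat t) = r then of_bool (y = 0) else 0)" for r
        using True by (simp add: c_def act_def)
      ultimately show ?thesis using True by (simp add: sum.delta)
    qed (auto simp: c_def act_def)
    show ?thesis
      by (simp add: p eq_time_def lhs_concat_map sum_list_distinct_conv_sum_set[OF assms(1)] sum_subtractf sum)
        (auto simp: c_def N_def)
  qed
  moreover have "lhs (eq_pending R) c p = of_bool (p = (0, int n))" for p
  proof -
    obtain t y where p: "p = (t, y)" by force
    let ?f = "\<lambda>r. int (c (UV r (fst r)) (t, y)) - (\<Sum>q\<leftarrow>snd r. int (c (UV r q) (t, y)))"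
    have prems: "lhs (map (\<lambda>p. (-1, (0, 0), UV r p)) ps) c p = - (\<Sum>q\<leftarrow>ps. int (c (UV r q) p))" for r ps p
      by (induction ps) (auto simp: zero_prod_def[symmetric])
    have "lhs (eq_pending R) c p = int (c UT (t, y)) - int (c UT (t - 1, y)) + (\<Sum>r\<in>set R. ?f r)"
      by (simp add: p eq_pending_def lhs_concat_map prems sum_list_distinct_conv_sum_set[OF assms(1)])
    also have "\<dots> = of_bool (t = 0 \<and> y = int n)"
    proof (cases "0 \<le> t \<and> t < N")
      case True
      let ?r = "fst (\<rho> ! nat t)"
      have t: "nat t < length \<rho>" using True by (simp add: N_def nat_less_iff)
      have 0: "?f r = 0" if "r \<noteq> ?r" for r
        using that by (simp add: c_def act_def)
      have count: "int (count (mset (map (tm_val (\<sigma> t)) ps)) (nat y)) = (\<Sum>q\<leftarrow>ps. int (c (UV ?r q) (t, y)))"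
        if "0 \<le> y" for ps
        using that True by (induction ps) (auto simp: c_def act_def)
      have neg: "(\<Sum>q\<leftarrow>ps. int (c (UV ?r q) (t, y))) = 0" if "y < 0" for ps
        using that by (induction ps) (auto simp: c_def)
      have "(\<Sum>r\<in>set R. ?f r) = ?f ?r"
        using Ms(3)[OF t] 0 by (subst sum.remove[of _ ?r]) (auto intro: sum.neutral)
      moreover have "int (c UT (t, y)) - int (c UT (t - 1, y)) + ?f ?r = of_bool (t = 0 \<and> y = int n)"
      proof (cases "0 \<le> y")
        case True
        have nat_y: "z = nat y \<longleftrightarrow> y = int z" for z using True by auto
        have "count (add_mset (tm_val (\<sigma> t) (fst ?r)) (Ms (Suc (nat t)))) (nat y) =
            count (Ms (nat t) + mset (map (tm_val (\<sigma> t)) (snd ?r))) (nat y)"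
          using Ms(4)[OF t] by (simp add: \<sigma>_def)
        then have *: "int (c UT (t, y)) + int (c (UV ?r (fst ?r)) (t, y)) =
            int (count (Ms (nat t)) (nat y)) + (\<Sum>q\<leftarrow>snd ?r. int (c (UV ?r q) (t, y)))"
          unfolding count_union of_nat_add[symmetric] count[OF True, symmetric] of_nat_eq_iff
          using True \<open>0 \<le> t \<and> t < N\<close> by (auto simp: c_def act_def nat_y)
        have "int (count (Ms (nat t)) (nat y)) = int (c UT (t - 1, y)) + of_bool (t = 0 \<and> y = int n)"
        proof (cases "t = 0")
          case False
          then have "nat t = Suc (nat (t - 1))" using \<open>0 \<le> t \<and> t < N\<close> by linarith
          then show ?thesis using False True \<open>0 \<le> t \<and> t < N\<close> by (simp add: c_def)
        qed (use True in \<open>auto simp: c_def Ms(1)\<close>)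
        then show ?thesis using * by simp
      next
        case False
        then show ?thesis using neg by (simp add: c_def)
      qed
      ultimately show ?thesis by simp
    next
      case False
      then have "c (UV r x) (t, y) = 0" for r x by (auto simp: c_def act_def)
      then have "?f r = 0" for r by simp
      \<comment> \<open>The run begins with the goal and ends with nothing, so it is not
        empty.\<close>
      moreover have N: "N \<noteq> 0" using Ms(1,2) by (auto simp: N_def)
      \<comment> \<open>At \<open>t = N\<close> the preceding state is the final, empty one, so
        cutting \<open>UT\<close> off there leaves no defect.\<close>
      moreover have "c UT (t - 1, y) = 0"
      proof (cases "t = N")
        case True
        then have "Suc (nat (t - 1)) = length \<rho>" using N N_def by linarith
        then show ?thesis using Ms(2) by (simp add: c_def)
      qed (use False in \<open>auto simp: c_def\<close>)
      ultimately show ?thesis using False by (auto simp: c_def N_def)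
    qed
    finally show ?thesis by (simp add: p)
  qed
  moreover have "lhs e c p = 0" if e: "e \<in> set (local_eqs r)" for r e p
  proof -
    obtain t y where p: "p = (t, y)" by force
    consider x where "e = eq_token r x" | k where "e = eq_num r k" | a b where "e = eq_node r a b"
      using e by (auto simp: local_eqs_def)
    then show ?thesis
    proof cases
      case 1
      then show ?thesis by (auto simp: p eq_token_def c_def)
    next
      case 2
      then show ?thesis by (auto simp: p eq_num_def c_def)
    next
      case 3
      let ?w = "w (tm_val (\<sigma> t) a) (tm_val (\<sigma> t) b)"
      have diff: "int (c (UWp r a b) (t, z)) - int (c (UWn r a b) (t, z)) = (if act r t then ?w z else 0)" for z
        by (simp add: c_def)
      have "lhs e c p = int (c (UV r (Add a b)) (t, y)) - int (c (UV r a) (t, y)) - int (c (UV r b) (t, y))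
         - int (c (UV r (Mul a b)) (t, y - 1)) + int (c (UV r (Mul a b)) (t, y)) + int (c (US r) (t, y - 1))
         - ((int (c (UWp r a b) (t, y - 3)) - int (c (UWn r a b) (t, y - 3)))
           - 3 * (int (c (UWp r a b) (t, y - 2)) - int (c (UWn r a b) (t, y - 2)))
           + 3 * (int (c (UWp r a b) (t, y - 1)) - int (c (UWn r a b) (t, y - 1)))
           - (int (c (UWp r a b) (t, y)) - int (c (UWn r a b) (t, y))))"
        unfolding 3 by (simp add: p eq_node_def)
      also have "\<dots> = 0"
        unfolding diff using w(2)[of y "tm_val (\<sigma> t) a" "tm_val (\<sigma> t) b"]
        by (cases "act r t") (simp_all add: c_def)
      finally show ?thesis .
    qed
  qed
  ultimately show ?thesis unfolding horn_solution_def by blast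
qed

text \<open>On the right only the queried word depends on \<open>n\<close>; the generators are fixed
  by \<open>R\<close>.\<close>

theorem derives_iff_in_submonoid:
  assumes "distinct R"
  shows "derives R n \<longleftrightarrow> in_submonoid (system_gens (horn_system R))
    (items_word (Suc (length (horn_system R))) [(0, 1, (0, 0)), (1, 1, (0, int n))])"
proof -
  have "derives R n \<longleftrightarrow> (\<exists>c. horn_solution R n c)"
    using derives_solution[OF assms] horn_sol.derives_goal[of R n] assms
    by (auto simp: horn_sol_def)
  also have "\<dots> \<longleftrightarrow> in_submonoid (system_gens (horn_system R))
    (items_word (Suc (length (horn_system R))) [(0, 1, (0, 0)), (1, 1, (0, int n))])"
    by (subst in_submonoid_system_iff) (simp add: horn_system_def, simp only: horn_system_solution_iff)
  finally show ?thesis .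
qed

section \<open>Recursive functions as Horn clauses\<close>

text \<open>A pairing built from sums and products alone, so that terms of rules can express it;
  Cantor's pairing would need a division by 2.\<close>

definition pr :: "nat \<Rightarrow> nat \<Rightarrow> nat" where
  "pr a b = (a + b) * (a + b) + a"

text \<open>The number \<open>pr a b\<close> lies between \<open>(a + b)^2\<close> and
  \<open>(a + b + 1)^2\<close>, so it determines \<open>a + b\<close>, and then
  \<open>a\<close>.\<close>

lemma pr_eq_iff [simp]: "pr a b = pr c d \<longleftrightarrow> a = c \<and> b = d"
proof
  assume eq: "pr a b = pr c d"
  have less: "pr x y < pr z w" if "x + y < z + w" for x y z w
  proof -
    have "pr x y < Suc (x + y) * Suc (x + y)" by (simp add: pr_def)
    also have "\<dots> \<le> (z + w) * (z + w)" using that by (intro mult_le_mono) auto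
    also have "\<dots> \<le> pr z w" by (simp add: pr_def)
    finally show ?thesis .
  qed
  have "a + b = c + d" using less[of a b c d] less[of c d a b] eq by linarith
  then show "a = c \<and> b = d" using eq by (simp add: pr_def)
qed simp

primrec list_code :: "nat list \<Rightarrow> nat" where
  "list_code [] = 0"
| "list_code (x # xs) = Suc (pr x (list_code xs))"

fun code :: "recf \<Rightarrow> nat" where
  "code Zero = pr 0 0"
| "code Succ = pr 1 0"
| "code (Proj i) = pr 2 i"
| "code (Comp f gs) = pr 3 (pr (code f) (list_code (map code gs)))"
| "code (Prec f g) = pr 4 (pr (code f) (code g))"
| "code (Mini f) = pr 5 (code f)"

text \<open>Facts about evaluation are even; the odd numbers are reserved for the goals of the
  diagonal argument.\<close>

definition ev :: "nat \<Rightarrow> nat \<Rightarrow> nat \<Rightarrow> nat" where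
  "ev f xs y = 2 * pr 0 (pr f (pr xs y))"

definition evs :: "nat \<Rightarrow> nat \<Rightarrow> nat \<Rightarrow> nat" where
  "evs gs xs ys = 2 * pr 1 (pr gs (pr xs ys))"

definition positive_below :: "nat \<Rightarrow> nat \<Rightarrow> nat \<Rightarrow> nat" where
  "positive_below f n xs = 2 * pr 2 (pr f (pr n xs))"

lemma facts_eq_iff [simp]:
  "ev a b c = ev a' b' c' \<longleftrightarrow> a = a' \<and> b = b' \<and> c = c'"
  "evs a b c = evs a' b' c' \<longleftrightarrow> a = a' \<and> b = b' \<and> c = c'"
  "positive_below a b c = positive_below a' b' c' \<longleftrightarrow> a = a' \<and> b = b' \<and> c = c'"
  "ev a b c \<noteq> evs a' b' c'" "ev a b c \<noteq> positive_below a' b' c'" "evs a b c \<noteq> positive_below a' b' c'"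
  "evs a b c \<noteq> ev a' b' c'" "positive_below a b c \<noteq> ev a' b' c'" "positive_below a b c \<noteq> evs a' b' c'"
  "Suc (2 * n) \<noteq> ev a b c" "Suc (2 * n) \<noteq> evs a b c" "Suc (2 * n) \<noteq> positive_below a b c"
  "ev a b c \<noteq> Suc (2 * n)" "evs a b c \<noteq> Suc (2 * n)" "positive_below a b c \<noteq> Suc (2 * n)"
  by (simp_all add: ev_def evs_def positive_below_def) presburger+

definition "tm_pr x y = Add (Mul (Add x y) (Add x y)) x"
definition "tm_Suc x = Add x (Num 1)"
definition "tm_Cons x y = tm_Suc (tm_pr x y)"
definition "tm_ev f xs y = Mul (Num 2) (tm_pr (Num 0) (tm_pr f (tm_pr xs y)))"
definition "tm_evs f xs y = Mul (Num 2) (tm_pr (Num 1) (tm_pr f (tm_pr xs y)))"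
definition "tm_positive_below f n xs = Mul (Num 2) (tm_pr (Num 2) (tm_pr f (tm_pr n xs)))"

lemma tm_val_simps [simp]:
  "tm_val \<sigma> (tm_pr x y) = pr (tm_val \<sigma> x) (tm_val \<sigma> y)"
  "tm_val \<sigma> (tm_Suc x) = Suc (tm_val \<sigma> x)"
  "tm_val \<sigma> (tm_Cons x y) = Suc (pr (tm_val \<sigma> x) (tm_val \<sigma> y))"
  "tm_val \<sigma> (tm_ev x y z) = ev (tm_val \<sigma> x) (tm_val \<sigma> y) (tm_val \<sigma> z)"
  "tm_val \<sigma> (tm_evs x y z) = evs (tm_val \<sigma> x) (tm_val \<sigma> y) (tm_val \<sigma> z)"
  "tm_val \<sigma> (tm_positive_below x y z) = positive_below (tm_val \<sigma> x) (tm_val \<sigma> y) (tm_val \<sigma> z)"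
  by (simp_all add: tm_pr_def pr_def tm_Suc_def tm_Cons_def tm_ev_def tm_evs_def
      tm_positive_below_def ev_def evs_def positive_below_def)

text \<open>An interpreter for all recursive functions at once. Projections recurse on their index,
  and \<open>positive_below\<close> replaces the bounded quantifier of minimisation, positivity
  being expressed by a successor. The last clause applies a function to its own code and turns the
  value 0 into an odd goal.\<close>

definition recf_rules :: "rule list" where
  "recf_rules =
    [(tm_ev (tm_pr (Num 0) (Num 0)) (Var 0) (Num 0), []),
     (tm_ev (tm_pr (Num 1) (Num 0)) (tm_Cons (Var 0) (Var 1)) (tm_Suc (Var 0)), []),
     (tm_ev (tm_pr (Num 2) (Num 0)) (tm_Cons (Var 0) (Var 1)) (Var 0), []),
     (tm_ev (tm_pr (Num 2) (tm_Suc (Var 2))) (tm_Cons (Var 0) (Var 1)) (Var 3),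
       [tm_ev (tm_pr (Num 2) (Var 2)) (Var 1) (Var 3)]),
     (tm_evs (Num 0) (Var 0) (Num 0), []),
     (tm_evs (tm_Cons (Var 0) (Var 1)) (Var 2) (tm_Cons (Var 3) (Var 4)),
       [tm_ev (Var 0) (Var 2) (Var 3), tm_evs (Var 1) (Var 2) (Var 4)]),
     (tm_ev (tm_pr (Num 3) (tm_pr (Var 0) (Var 1))) (Var 2) (Var 3),
       [tm_evs (Var 1) (Var 2) (Var 4), tm_ev (Var 0) (Var 4) (Var 3)]),
     (tm_ev (tm_pr (Num 4) (tm_pr (Var 0) (Var 1))) (tm_Cons (Num 0) (Var 2)) (Var 3),
       [tm_ev (Var 0) (Var 2) (Var 3)]),
     (tm_ev (tm_pr (Num 4) (tm_pr (Var 0) (Var 1))) (tm_Cons (tm_Suc (Var 4)) (Var 2)) (Var 3),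
       [tm_ev (tm_pr (Num 4) (tm_pr (Var 0) (Var 1))) (tm_Cons (Var 4) (Var 2)) (Var 5),
        tm_ev (Var 1) (tm_Cons (Var 4) (tm_Cons (Var 5) (Var 2))) (Var 3)]),
     (tm_ev (tm_pr (Num 5) (Var 0)) (Var 1) (Var 2),
       [tm_ev (Var 0) (tm_Cons (Var 2) (Var 1)) (Num 0), tm_positive_below (Var 0) (Var 2) (Var 1)]),
     (tm_positive_below (Var 0) (Num 0) (Var 1), []),
     (tm_positive_below (Var 0) (tm_Suc (Var 2)) (Var 1),
       [tm_positive_below (Var 0) (Var 2) (Var 1), tm_ev (Var 0) (tm_Cons (Var 2) (Var 1)) (tm_Suc (Var 3))]),
     (tm_Suc (Mul (Num 2) (Var 0)), [tm_ev (Var 0) (tm_Cons (Var 0) (Num 0)) (Num 0)])]"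

lemma distinct_recf_rules: "distinct recf_rules"
  by (simp add: recf_rules_def tm_ev_def tm_evs_def tm_positive_below_def tm_pr_def tm_Suc_def tm_Cons_def)

lemma derives_nth:
  assumes "i < length R" "\<forall>p\<in>set (snd (R ! i)). derives R (tm_val ((!) vs) p)"
  shows "derives R (tm_val ((!) vs) (fst (R ! i)))"
  using assms by (intro derives_rule[of "fst (R ! i)" "snd (R ! i)"]) auto

lemma derives_eval:
  "eval f xs y \<Longrightarrow> derives recf_rules (ev (code f) (list_code xs) y)"
proof (induction rule: eval.induct)
  case (ev_zero xs)
  then show ?case
    using derives_nth[of 0 recf_rules "[list_code xs]"] by (simp add: recf_rules_def)
next
  case (ev_succ x xs)
  then show ?case
    using derives_nth[of 1 recf_rules "[x, list_code xs]"] by (simp add: recf_rules_def)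
next
  case (ev_proj i xs)
  then show ?case
  proof (induction i arbitrary: xs)
    case 0
    then obtain x xs' where "xs = x # xs'" by (cases xs) auto
    then show ?case
      using derives_nth[of 2 recf_rules "[x, list_code xs']"] by (simp add: recf_rules_def)
  next
    case (Suc i)
    then obtain x xs' where xs: "xs = x # xs'" by (cases xs) auto
    have "derives recf_rules (ev (pr 2 i) (list_code xs') (xs' ! i))"
      using Suc.IH[of xs'] Suc.prems xs by simp
    then show ?case
      using derives_nth[of 3 recf_rules "[x, list_code xs', i, xs' ! i]"] xs
      by (simp add: recf_rules_def)
  qed
next
  case (ev_comp xs gs ys f z)
  have "derives recf_rules (evs (list_code (map code gs)) (list_code xs) (list_code ys))"
    using ev_comp(1)
  proof (induction rule: list_all2_induct)
    case Nil
    then show ?case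
      using derives_nth[of 4 recf_rules "[list_code xs]"] by (simp add: recf_rules_def)
  next
    case (Cons g gs y ys)
    then show ?case
      using derives_nth[of 5 recf_rules "[code g, list_code (map code gs), list_code xs, y, list_code ys]"]
      by (simp add: recf_rules_def)
  qed
  then show ?case
    using ev_comp(2) derives_nth[of 6 recf_rules
        "[code f, list_code (map code gs), list_code xs, z, list_code ys]"]
    by (simp add: recf_rules_def)
next
  case (ev_prec0 f xs y g)
  then show ?case
    using derives_nth[of 7 recf_rules "[code f, code g, list_code xs, y]"] by (simp add: recf_rules_def)
next
  case (ev_precS f g n xs y z)
  then show ?case
    using derives_nth[of 8 recf_rules "[code f, code g, list_code xs, z, n, y]"]
    by (simp add: recf_rules_def)
next
  case (ev_mini f n xs)
  have "derives recf_rules (positive_below (code f) k (list_code xs))" if "k \<le> n" for k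
    using that
  proof (induction k)
    case 0
    then show ?case
      using derives_nth[of 10 recf_rules "[code f, list_code xs]"] by (simp add: recf_rules_def)
  next
    case (Suc k)
    then obtain y where "derives recf_rules (ev (code f) (list_code (k # xs)) (Suc y))"
      using ev_mini(3) by (metis Suc_le_eq gr0_implies_Suc)
    then show ?case
      using Suc derives_nth[of 11 recf_rules "[code f, list_code xs, k, y]"]
      by (simp add: recf_rules_def)
  qed
  then show ?case
    using ev_mini(2) derives_nth[of 9 recf_rules "[code f, list_code xs, n]"]
    by (simp add: recf_rules_def)
qed

text \<open>The variables of a clause range over all numbers, so facts about numbers that code
  nothing are derived too; the invariant speaks only of genuine codes. The output of
  \<open>evs\<close> is the exception: that it codes a list is part of the claim, as composition
  needs this for its inner values.\<close>

definition fact_sound :: "nat \<Rightarrow> bool" where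
  "fact_sound N \<longleftrightarrow>
     (\<forall>f xs y. N = ev (code f) (list_code xs) y \<longrightarrow> eval f xs y) \<and>
     (\<forall>gs xs ys. N = evs (list_code (map code gs)) (list_code xs) ys \<longrightarrow>
        (\<exists>zs. ys = list_code zs \<and> list_all2 (\<lambda>g y. eval g xs y) gs zs)) \<and>
     (\<forall>f n xs. N = positive_below (code f) n (list_code xs) \<longrightarrow> (\<forall>m<n. \<exists>y. eval f (m # xs) y \<and> 0 < y)) \<and>
     (\<forall>f. N = Suc (2 * code f) \<longrightarrow> eval f [code f] 0)"

lemma list_code_eq:
  "list_code xs = Suc (pr a b) \<longleftrightarrow> (\<exists>ys. xs = a # ys \<and> b = list_code ys)"
  "Suc (pr a b) = list_code xs \<longleftrightarrow> (\<exists>ys. xs = a # ys \<and> b = list_code ys)"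
  "list_code xs = 0 \<longleftrightarrow> xs = []" "0 = list_code xs \<longleftrightarrow> xs = []"
  by (cases xs; auto)+

lemma code_eq:
  "pr 0 0 = code f \<longleftrightarrow> f = Zero"
  "pr (Suc 0) 0 = code f \<longleftrightarrow> f = Succ"
  "pr 2 i = code f \<longleftrightarrow> f = Proj i"
  "pr 3 (pr a b) = code f \<longleftrightarrow> (\<exists>g gs. f = Comp g gs \<and> a = code g \<and> b = list_code (map code gs))"
  "pr 4 (pr a b) = code f \<longleftrightarrow> (\<exists>g h. f = Prec g h \<and> a = code g \<and> b = code h)"
  "pr 5 a = code f \<longleftrightarrow> (\<exists>g. f = Mini g \<and> a = code g)"
  by (cases f; auto)+

lemma derives_sound: "derives recf_rules N \<Longrightarrow> fact_sound N"
proof (induction rule: derives.induct)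
  case (derives_rule h ps \<sigma>)
  have prems: "\<forall>p\<in>set ps. fact_sound (tm_val \<sigma> p)"
    using derives_rule by blast
  have evD: "eval f xs y" if "fact_sound (ev (code f) (list_code xs) y)" for f xs y
    using that by (simp add: fact_sound_def)
  have evsD: "\<exists>zs. ys = list_code zs \<and> list_all2 (\<lambda>g y. eval g xs y) gs zs"
    if "fact_sound (evs (list_code (map code gs)) (list_code xs) ys)" for gs xs ys
    using that unfolding fact_sound_def by blast
  have posD: "\<forall>m<n. \<exists>y. eval f (m # xs) y \<and> 0 < y"
    if "fact_sound (positive_below (code f) n (list_code xs))" for f n xs
    using that unfolding fact_sound_def by blast
  have pos0: "fact_sound (positive_below f 0 xs)" for f xs
    by (simp add: fact_sound_def)
  have posS: "fact_sound (positive_below f (Suc n) xs)"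
    if "fact_sound (positive_below f n xs)" "fact_sound (ev f (Suc (pr n xs)) (Suc y))" for f n xs y
  proof -
    have "\<forall>m<Suc n. \<exists>y. eval g (m # zs) y \<and> 0 < y" if "f = code g" "xs = list_code zs" for g zs
      using that posD[of g n zs] evD[of g "n # zs" "Suc y"] \<open>fact_sound (positive_below f n xs)\<close>
        \<open>fact_sound (ev f (Suc (pr n xs)) (Suc y))\<close> by (auto simp: less_Suc_eq)
    then show ?thesis by (simp add: fact_sound_def)
  qed
  have evs0: "fact_sound (evs 0 xs 0)" for xs
    by (auto simp: fact_sound_def list_code_eq intro: exI[of _ "[]"])
  have evsS: "fact_sound (evs (Suc (pr g gs)) xs (Suc (pr y ys)))"
    if "fact_sound (ev g xs y)" "fact_sound (evs gs xs ys)" for g gs xs y ys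
  proof -
    have "\<exists>zs. Suc (pr y ys) = list_code zs \<and> list_all2 (\<lambda>g y. eval g xs' y) hs zs"
      if eq: "Suc (pr g gs) = list_code (map code hs)" "xs = list_code xs'" for hs xs'
    proof -
      obtain h hs' where hs: "hs = h # hs'" "g = code h" "gs = list_code (map code hs')"
        using eq(1) by (cases hs) auto
      have "eval h xs' y" using \<open>fact_sound (ev g xs y)\<close> hs eq(2) evD by simp
      moreover obtain zs where "ys = list_code zs" "list_all2 (\<lambda>g y. eval g xs' y) hs' zs"
        using \<open>fact_sound (evs gs xs ys)\<close> hs eq(2) evsD by blast
      ultimately show ?thesis by (intro exI[of _ "y # zs"]) (simp add: hs)
    qed
    then show ?thesis by (simp add: fact_sound_def)
  qed
  have evI: "fact_sound (ev f xs y)"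
    if "\<And>g zs. f = code g \<Longrightarrow> xs = list_code zs \<Longrightarrow> eval g zs y" for f xs y
    using that by (simp add: fact_sound_def)
  have comp: "fact_sound (ev (pr 3 (pr f gs)) xs z)"
    if prem: "fact_sound (evs gs xs ys)" "fact_sound (ev f ys z)" for f gs xs ys z
  proof (rule evI)
    fix g zs assume "pr 3 (pr f gs) = code g" and xs: "xs = list_code zs"
    then obtain h hs where g: "g = Comp h hs" "f = code h" "gs = list_code (map code hs)"
      unfolding code_eq by blast
    obtain ws where "ys = list_code ws" "list_all2 (\<lambda>g y. eval g zs y) hs ws"
      using prem(1) g xs evsD by blast
    then show "eval g zs z" using prem(2) g evD ev_comp by blast
  qed
  have mini: "fact_sound (ev (pr 5 f) xs n)"
    if "fact_sound (ev f (Suc (pr n xs)) 0)" "fact_sound (positive_below f n xs)" for f xs n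
  proof (rule evI)
    fix g zs assume "pr 5 f = code g" and xs: "xs = list_code zs"
    then obtain h where g: "g = Mini h" "f = code h" unfolding code_eq by blast
    then show "eval g zs n"
      using that xs evD[of h "n # zs" 0] posD[of h n zs] by (auto intro: ev_mini)
  qed
  have precS: "fact_sound (ev (pr 4 (pr f g)) (Suc (pr (Suc n) xs)) z)"
    if "fact_sound (ev (pr 4 (pr f g)) (Suc (pr n xs)) y)"
      "fact_sound (ev g (Suc (pr n (Suc (pr y xs)))) z)" for f g n xs y z
  proof (rule evI)
    fix k zs assume "pr 4 (pr f g) = code k" and xs: "Suc (pr (Suc n) xs) = list_code zs"
    then obtain f' g' where k: "k = Prec f' g'" "f = code f'" "g = code g'" unfolding code_eq by blast
    obtain ws where zs: "zs = Suc n # ws" "xs = list_code ws" using xs list_code_eq by auto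
    have "eval k (n # ws) y" "eval g' (n # y # ws) z"
      using that evD[of k "n # ws" y] evD[of g' "n # y # ws" z] k zs by simp_all
    then show "eval k zs z" unfolding k zs by (rule ev_precS)
  qed
  have proj0: "eval (Proj 0) (x # xs) x" for x xs
    using ev_proj[of 0 "x # xs"] by simp
  have projS: "eval (Proj (Suc i)) (x # xs) y" if "eval (Proj i) xs y" for i x xs y
    using that ev_proj[of "Suc i" "x # xs"] by (cases rule: eval.cases) auto
  have zero: "fact_sound (ev (pr 0 0) xs 0)" for xs
    by (auto intro!: evI ev_zero simp: code_eq)
  have succ: "fact_sound (ev (pr (Suc 0) 0) (Suc (pr x xs)) (Suc x))" for x xs
    by (auto intro!: evI ev_succ simp: code_eq list_code_eq)
  have projZ: "fact_sound (ev (pr 2 0) (Suc (pr x xs)) x)" for x xs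
    by (auto intro!: evI proj0 simp: code_eq list_code_eq)
  have projN: "fact_sound (ev (pr 2 (Suc i)) (Suc (pr x xs)) y)" if "fact_sound (ev (pr 2 i) xs y)" for i x xs y
    using that evD[of "Proj _"] by (auto intro!: evI projS simp: code_eq list_code_eq)
  have prec0: "fact_sound (ev (pr 4 (pr f g)) (Suc (pr 0 xs)) y)" if "fact_sound (ev f xs y)" for f g xs y
    using that evD by (auto intro!: evI ev_prec0 simp: code_eq list_code_eq)
  have goal: "fact_sound (Suc (2 * n))" if "fact_sound (ev n (Suc (pr n 0)) 0)" for n
    using that evD[of _ "[n]" 0] by (auto simp: fact_sound_def)
  from derives_rule(1) show ?case
    unfolding recf_rules_def set_simps insert_iff empty_iff simp_thms
    by (elim disjE Pair_inject; use prems in \<open>auto intro: zero succ projZ projN evs0 evsS comp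
        prec0 precS mini pos0 posS goal\<close>)
qed

lemma derives_goal_iff_eval: "derives recf_rules (Suc (2 * code f)) \<longleftrightarrow> eval f [code f] 0"
proof
  assume "eval f [code f] 0"
  then show "derives recf_rules (Suc (2 * code f))"
    using derives_eval[of f "[code f]" 0] derives_nth[of 12 recf_rules "[code f]"]
    by (simp add: recf_rules_def)
next
  assume "derives recf_rules (Suc (2 * code f))"
  then show "eval f [code f] 0" using derives_sound unfolding fact_sound_def by blast
qed

section \<open>Computability of the queries and diagonalisation\<close>

lemma eval_deterministic: "eval f xs y \<Longrightarrow> eval f xs z \<Longrightarrow> y = z"
proof (induction arbitrary: z rule: eval.induct)
  case (ev_comp xs gs ys f w)
  from ev_comp(4) obtain zs where zs: "list_all2 (\<lambda>g y. eval g xs y) gs zs" "eval f zs z"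
    by (cases rule: eval.cases) auto
  have "ys = zs"
    using ev_comp(1) zs(1)
  proof (induction arbitrary: zs rule: list_all2_induct)
    case (Cons g gs y ys)
    then show ?case by (cases zs) auto
  qed simp
  then show ?case using ev_comp zs(2) by blast
next
  case (ev_precS f g n xs y w)
  from ev_precS(5) obtain y' where "eval (Prec f g) (n # xs) y'" "eval g (n # y' # xs) z"
    by (cases rule: eval.cases) auto
  then show ?case using ev_precS by blast
next
  case (ev_mini f n xs)
  from ev_mini(4) have z: "eval f (z # xs) 0" "\<forall>m<z. \<exists>y. eval f (m # xs) y \<and> 0 < y"
    by (cases rule: eval.cases; auto)+
  show ?case
  proof (rule linorder_cases[of n z])
    assume "n < z"
    then show ?thesis using z ev_mini(2) by (metis less_numeral_extra(3))
  next
    assume "z < n"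
    then show ?thesis using z ev_mini(3) by (metis less_numeral_extra(3))
  qed
qed (erule eval.cases; auto)+

definition computable :: "(nat \<Rightarrow> nat) \<Rightarrow> bool" where
  "computable h \<longleftrightarrow> (\<exists>r. \<forall>x. eval r [x] (h x))"

lemma computable_Suc: "computable Suc"
  unfolding computable_def by (intro exI[of _ Succ]) (auto intro: ev_succ)

lemma computable_0: "computable (\<lambda>_. 0)"
  unfolding computable_def by (intro exI[of _ Zero]) (auto intro: ev_zero)

lemma computable_comp:
  assumes "computable g" "computable h" shows "computable (\<lambda>x. g (h x))"
proof -
  obtain r s where "\<And>x. eval r [x] (g x)" "\<And>x. eval s [x] (h x)"
    using assms unfolding computable_def by blast
  then have "eval (Comp r [s]) [x] (g (h x))" for x
    by (intro ev_comp[of _ _ "[h x]"]) auto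
  then show ?thesis unfolding computable_def by blast
qed

text \<open>The number of iterations and the starting value depend on the same argument, as in a
  power with exponent \<open>n\<close> followed by a word that itself depends on
  \<open>n\<close>.\<close>

lemma computable_iterate:
  assumes "computable h" "computable g" shows "computable (\<lambda>n. (h ^^ n) (g n))"
proof -
  obtain r s where r: "\<And>x. eval r [x] (h x)" and s: "\<And>x. eval s [x] (g x)"
    using assms unfolding computable_def by blast
  \<comment> \<open>The step function receives the counter, the previous value and the parameter;
    \<open>Proj 1\<close> selects the previous value.\<close>
  let ?r = "Prec (Proj 0) (Comp r [Proj 1])"
  have it: "eval ?r [n, z] ((h ^^ n) z)" for n z
  proof (induction n)
    case 0
    then show ?case using ev_proj[of 0 "[z]"] by (auto intro: ev_prec0)
  next
    case (Suc n)
    have "eval (Comp r [Proj 1]) [n, (h ^^ n) z, z] (h ((h ^^ n) z))"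
      using r ev_proj[of 1 "[n, (h ^^ n) z, z]"] by (intro ev_comp[of _ _ "[(h ^^ n) z]"]) auto
    then show ?case using Suc by (auto intro: ev_precS)
  qed
  have "eval (Comp ?r [Proj 0, s]) [n] ((h ^^ n) (g n))" for n
    using it[of n "g n"] s[of n] ev_proj[of 0 "[n]"] by (intro ev_comp[of _ _ "[n, g n]"]) auto
  then show ?thesis unfolding computable_def by blast
qed

lemma computable_id: "computable (\<lambda>z. z)"
  unfolding computable_def using ev_proj[of 0 "[_]"] by (intro exI[of _ "Proj 0"]) simp

lemma computable_affine: "computable (\<lambda>z. a + b * z)"
proof -
  have add: "computable (\<lambda>z. k + z)" for k
  proof (induction k)
    case (Suc k)
    then show ?case using computable_comp[OF computable_Suc] by simp
  qed (simp add: computable_id)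
  have "((\<lambda>z. b + z) ^^ n) 0 = b * n" for n
    by (induction n) auto
  then have "computable (\<lambda>z. b * z)"
    using computable_iterate[OF add[of b] computable_0] by simp
  then show ?thesis by (rule computable_comp[OF add])
qed

text \<open>The effect on codes of putting a fixed word in front: an affine map, so a power of a
  fixed word becomes an iterated affine map.\<close>

definition prepend_code :: "word \<Rightarrow> nat \<Rightarrow> nat" where
  "prepend_code u = foldr (\<lambda>l z. letter_code l + 5 * z) u"

lemma word_code_append: "word_code (u @ v) = prepend_code u (word_code v)"
  by (induction u) (auto simp: prepend_code_def)

lemma word_code_concat_replicate:
  "word_code (concat (replicate n u) @ v) = (prepend_code u ^^ n) (word_code v)"
  by (induction n) (auto simp: word_code_append)

lemma computable_prepend_code: "computable (prepend_code u)"
proof (induction u)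
  case Nil
  then show ?case using computable_id by (simp add: prepend_code_def id_def)
next
  case (Cons l u)
  have "prepend_code (l # u) = (\<lambda>z. letter_code l + 5 * prepend_code u z)"
    by (auto simp: prepend_code_def)
  then show ?case using computable_comp[OF computable_affine Cons] by simp
qed

text \<open>The base 5 digits are all nonzero, so the code also determines the length.\<close>

lemma inj_word_code: "inj word_code"
proof (rule injI)
  have letter: "letter_code l < 5 \<and> letter_code l \<noteq> 0" for l by (cases l) auto
  have inj_letter: "letter_code l = letter_code l' \<Longrightarrow> l = l'" for l l' by (cases l; cases l') auto
  fix u v show "word_code u = word_code v \<Longrightarrow> u = v"
  proof (induction u arbitrary: v)
    case Nil
    then show ?case using letter by (cases v) auto
  next
    case (Cons l u)
    then obtain l' v' where v: "v = l' # v'" using letter[of l] by (cases v) auto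
    have eq: "letter_code l + 5 * word_code u = letter_code l' + 5 * word_code v'"
      using Cons(2) v by simp
    then have "letter_code l = letter_code l'"
      using letter[of l] letter[of l'] by presburger
    then show ?case using eq Cons(1) inj_letter v by auto
  qed
qed

definition query :: "nat \<Rightarrow> word" where
  "query n = items_word (Suc (length (horn_system recf_rules)))
     [(0, 1, (0, 0)), (1, 1, (0, int (Suc (2 * n))))]"

text \<open>Isolates the dependence on \<open>n\<close> in two powers with exponent
  \<open>n\<close>. The goal is \<open>2 * n + 1\<close>, hence the blocks of two letters and the
  single letter attached to each fixed part.\<close>

lemma query_eq:
  "query n = (basis_word 0 @ [Ly]) @ concat (replicate n [Ly, Ly]) @
     (basis_word 1 @ [LyI]) @ concat (replicate n [LyI, LyI]) @ []"
proof -
  have rep: "replicate (Suc (2 * n)) l = l # concat (replicate n [l, l])" for l :: letter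
    by (induction n) auto
  have pow: "letter_pow Ly (int (Suc (2 * n))) = Ly # concat (replicate n [Ly, Ly])"
    "letter_pow Ly (- int (Suc (2 * n))) = LyI # concat (replicate n [LyI, LyI])"
    by (simp_all add: letter_pow_def rep del: replicate_Suc of_nat_Suc)
  show ?thesis
    unfolding query_def items_word_def item_word_def at_lattice_def
    by (simp add: xy_def lattice_def word_pow_def inv_word_letter_pow pow del: of_nat_Suc)
qed

lemma computable_query: "computable (\<lambda>n. word_code (query n))"
  unfolding query_eq word_code_append[of "_ @ [_]"] word_code_concat_replicate
  by (intro computable_comp[OF computable_prepend_code] computable_iterate computable_prepend_code)
    (use computable_0 in simp)

theorem theorem2:
  shows "\<exists>gens :: word list. \<not> decidable_words (in_submonoid gens)"
proof (intro exI notI)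
  let ?gens = "system_gens (horn_system recf_rules)"
  assume "decidable_words (in_submonoid ?gens)"
  then obtain d where d: "\<And>n. eval d [n] (if n \<in> word_code ` {w. in_submonoid ?gens w} then 1 else 0)"
    unfolding decidable_words_def decidable_nat_def by blast
  have "n \<in> word_code ` {w. in_submonoid ?gens w} \<longleftrightarrow> in_submonoid ?gens w" if "n = word_code w" for n w
    using that inj_word_code by (auto dest: injD)
  then have d: "eval d [word_code w] (if in_submonoid ?gens w then 1 else 0)" for w
    using d[of "word_code w"] by simp
  obtain r where r: "\<And>n. eval r [n] (word_code (query n))"
    using computable_query unfolding computable_def by blast
  \<comment> \<open>The diagonal function answers, on input \<open>n\<close>, whether
    \<open>query n\<close> lies in the submonoid. For its own code, membership means that its value
    is 0, while the value 0 is its answer for non-membership.\<close>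
  let ?f = "Comp d [r]"
  have f: "eval ?f [n] (if in_submonoid ?gens (query n) then 1 else 0)" for n
    using r[of n] d[of "query n"] by (intro ev_comp[of _ _ "[word_code (query n)]"]) auto
  have "in_submonoid ?gens (query (code ?f)) \<longleftrightarrow> eval ?f [code ?f] 0"
    using derives_iff_in_submonoid[OF distinct_recf_rules] derives_goal_iff_eval[of ?f]
    unfolding query_def by blast
  then show False
    using f[of "code ?f"] eval_deterministic[of ?f "[code ?f]" 0 1] by (auto split: if_splits)
qed

end
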